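(* Let $G$ be a maximal planar graph of order $n\ge 3$. Then $G$ can be contracted to $K_3$ by a suitable finite sequence of contracting $i$-wheel operations with $i\in\{2,3,4,5\}$.
   Context: A maximal planar graph is a plane graph all of whose faces (including the infinite one) are triangles. Graphs are simple, except that graphs containing a 2-wheel are allowed: parallel edges forming a 2-cycle with vertices on both sides may occur (in particular they may be created by the operations below), and a vertex of degree $2$ lying in a region bounded by a 2-cycle (a pair of parallel edges) and joined to both of its vertices is the center of a 2-wheel $W_2$. Contracting operations on a maximal planar graph: - Contracting 2-wheel: delete the degree-2 center of a 2-wheel with its two edges, then delete one of the two parallel edges of its 2-cycle. - Contracting 3-wheel: delete a vertex of degree $3$ with its incident edges. - Contracting 4-wheel: delete a vertex $v$ of degree $4$ with its incident edges, and then identify a pair of nonadjacent vertices among the four neighbors of $v$ inside the resulting face (pairs of edges that come to bound a face of degree two are merged into one edge). - Contracting 5-wheel: delete a vertex $v$ of degree $5$ with its incident edges, and then identify a pair of nonadjacent vertices among the five neighbors of $v$ inside the resulting face (pairs of edges that come to bound a face of degree two are merged into one edge). *)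

theory Defs
  imports
    Graph_Theory.Bidirected_Digraph
    Graph_Theory.Kuratowski
    "HOL-Combinatorics.Orbits"
    "HOL-Combinatorics.Transposition"
begin

text \<open>
  A plane graph, possibly with parallel edges, is represented by its rotation system
  (combinatorial map). An undirected edge is a pair of mutually reverse arcs, exchanged by
  the involution \<open>rev_arc\<close>; thus \<open>out_degree\<close> is the degree of a vertex, parallel edges being
  counted separately. The permutation \<open>rot\<close> maps every arc to the next arc
  with the same tail in the (say clockwise) order around that vertex.
\<close>

record ('v, 'e) comb_map =
  skel :: "('v, 'e) pre_digraph"
  rev_arc :: "'e \<Rightarrow> 'e"
  rot :: "'e \<Rightarrow> 'e"

text \<open>
  \<open>face_succ\<close> walks along the boundary of a face; its orbits on the arcs are the faces
  (all of them, including the infinite one). The corner of the face walk at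
  \<open>tail a\<close> just before traversing \<open>a\<close> lies between the arc preceding \<open>a\<close> in the rotation and \<open>a\<close>.
\<close>

definition face_succ :: "('v, 'e) comb_map \<Rightarrow> 'e \<Rightarrow> 'e" where
  "face_succ M = rot M \<circ> rev_arc M"

definition face :: "('v, 'e) comb_map \<Rightarrow> 'e \<Rightarrow> 'e set" where
  "face M a = orbit (face_succ M) a"

definition faces :: "('v, 'e) comb_map \<Rightarrow> 'e set set" where
  "faces M = face M ` arcs (skel M)"

text \<open>
  A connected rotation system describes an embedding into the sphere (equivalently, the plane)
  iff its Euler characteristic is 2. The graph with one vertex and no edge, whose single face
  is not an orbit of arcs, is not covered; it has no triangular face.
\<close>

locale plane_map =
  fin_digraph "skel M" + bidirected_digraph "skel M" "rev_arc M"
  for M :: "('v, 'e) comb_map" +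
  assumes rot_permutes: "rot M permutes arcs (skel M)"
    and rot_cyclic: "\<And>v. v \<in> verts (skel M) \<Longrightarrow> out_arcs (skel M) v \<noteq> {} \<Longrightarrow>
          cyclic_on (rot M) (out_arcs (skel M) v)"
    and connected_skel: "connected (skel M)"
    and euler: "int (card (verts (skel M))) - int (card (arcs (skel M)) div 2)
          + int (card (faces M)) = 2"

text \<open>
  As there are no loops, a face of length 3 has three distinct corners, i.e. it is a triangle.
  As there is no face of length 2, each side of a 2-cycle contains a vertex.
\<close>

locale maximal_planar = plane_map M + loopfree_digraph "skel M"
  for M :: "('v, 'e) comb_map" +
  assumes triangular: "\<And>f. f \<in> faces M \<Longrightarrow> card f = 3"

definition adjacent :: "('v, 'e) comb_map \<Rightarrow> 'v \<Rightarrow> 'v \<Rightarrow> bool" where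
  "adjacent M u v \<longleftrightarrow> (u, v) \<in> arcs_ends (skel M)"

definition neighbors :: "('v, 'e) comb_map \<Rightarrow> 'v \<Rightarrow> 'v set" where
  "neighbors M v = {u. adjacent M v u}"

text \<open>
  Deleting edges and vertices: every remaining arc is followed, in the rotation, by
  the first remaining arc after it.
\<close>

definition next_in :: "('e \<Rightarrow> 'e) \<Rightarrow> 'e set \<Rightarrow> 'e \<Rightarrow> 'e" where
  "next_in f S a = (if a \<in> S then (f ^^ (LEAST n. 0 < n \<and> (f ^^ n) a \<in> S)) a else a)"

definition restrict_to :: "('v, 'e) comb_map \<Rightarrow> ('v, 'e) pre_digraph \<Rightarrow> ('v, 'e) comb_map" where
  "restrict_to M H = \<lparr>skel = H,
     rev_arc = perm_restrict (rev_arc M) (arcs H),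
     rot = next_in (rot M) (arcs H)\<rparr>"

definition delete_vertex :: "('v, 'e) comb_map \<Rightarrow> 'v \<Rightarrow> ('v, 'e) comb_map" where
  "delete_vertex M v = restrict_to M (pre_digraph.del_vert (skel M) v)"

definition delete_edge :: "('v, 'e) comb_map \<Rightarrow> 'e \<Rightarrow> ('v, 'e) comb_map" where
  "delete_edge M a =
     restrict_to M (pre_digraph.del_arc (pre_digraph.del_arc (skel M) a) (rev_arc M a))"

text \<open>
  If \<open>a\<close> and \<open>b\<close> are arcs on the same face with distinct tails, \<open>identify\<close> merges \<open>tail b\<close>
  into \<open>tail a\<close> through the interior of that face: the two rotations are
  spliced at the corners preceding \<open>a\<close> and \<open>b\<close>, so that the face walk
  splits into one closed walk through \<open>a\<close> and another one through \<open>b\<close>.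
\<close>

definition identify :: "('v, 'e) comb_map \<Rightarrow> 'e \<Rightarrow> 'e \<Rightarrow> ('v, 'e) comb_map" where
  "identify M a b =
    (let G = skel M; r = (\<lambda>x. if x = tail G b then tail G a else x)
     in \<lparr>skel = \<lparr>verts = r ` verts G, arcs = arcs G, tail = r \<circ> tail G, head = r \<circ> head G\<rparr>,
         rev_arc = rev_arc M,
         rot = transpose a b \<circ> rot M\<rparr>)"

text \<open>
  A face of degree two bounded by a pair of different edges; a single edge seen from both of
  its sides is excluded.
\<close>

definition digon :: "('v, 'e) comb_map \<Rightarrow> 'e \<Rightarrow> bool" where
  "digon M a \<longleftrightarrow> a \<in> arcs (skel M) \<and> card (face M a) = 2 \<and> face_succ M a \<noteq> rev_arc M a"

definition merge_digon :: "('v, 'e) comb_map \<Rightarrow> ('v, 'e) comb_map \<Rightarrow> bool" where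
  "merge_digon M N \<longleftrightarrow> (\<exists>a. digon M a \<and> N = delete_edge M a)"

definition merge_digons :: "('v, 'e) comb_map \<Rightarrow> ('v, 'e) comb_map \<Rightarrow> bool" where
  "merge_digons M N \<longleftrightarrow> merge_digon\<^sup>*\<^sup>* M N \<and> \<not> (\<exists>a. digon N a)"

text \<open>
  In a triangulation, a vertex of degree \<open>i \<ge> 3\<close> with \<open>i\<close> distinct neighbours is the center of an
  \<open>i\<close>-wheel; its rim bounds the face that results from deleting the vertex.
\<close>

definition wheel_center :: "('v, 'e) comb_map \<Rightarrow> nat \<Rightarrow> 'v \<Rightarrow> bool" where
  "wheel_center M i v \<longleftrightarrow> v \<in> verts (skel M) \<and>
     out_degree (skel M) v = i \<and> card (neighbors M v) = i"

text \<open>The arcs of the remaining graph that lie on a face of \<open>M\<close> incident with \<open>v\<close>.\<close>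

definition rim :: "('v, 'e) comb_map \<Rightarrow> 'v \<Rightarrow> 'e set" where
  "rim M v = {a \<in> arcs (skel (delete_vertex M v)). \<exists>d \<in> face M a. tail (skel M) d = v}"

text \<open>
  For a 2-wheel, the condition that the rim becomes a face bounded by two different
  edges says that the neighbours are joined by a pair of parallel edges bounding
  the region of \<open>v\<close>; it excludes the vertices of a bare triangle.
\<close>

inductive contract_wheel :: "nat \<Rightarrow> ('v, 'e) comb_map \<Rightarrow> ('v, 'e) comb_map \<Rightarrow> bool" where
  wheel2: "\<lbrakk>maximal_planar M; wheel_center M 2 v; N = delete_vertex M v;
      a \<in> rim M v; digon N a\<rbrakk>
    \<Longrightarrow> contract_wheel 2 M (delete_edge N a)"
| wheel3: "\<lbrakk>maximal_planar M; wheel_center M 3 v\<rbrakk>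
    \<Longrightarrow> contract_wheel 3 M (delete_vertex M v)"
| wheel45: "\<lbrakk>maximal_planar M; i \<in> {4, 5}; wheel_center M i v; N = delete_vertex M v;
      a \<in> rim M v; b \<in> rim M v; b \<in> face N a;
      tail (skel M) a \<noteq> tail (skel M) b; \<not> adjacent M (tail (skel M) a) (tail (skel M) b);
      merge_digons (identify N a b) M'\<rbrakk>
    \<Longrightarrow> contract_wheel i M M'"

definition contracts :: "('v, 'e) comb_map \<Rightarrow> ('v, 'e) comb_map \<Rightarrow> bool" where
  "contracts M N \<longleftrightarrow> (\<exists>i \<in> {2, 3, 4, 5}. contract_wheel i M N)"

end

theory Submission
  imports Defs
begin

text \<open>
  Since the Euler characteristic is 2, every set of edges that is even at all vertices bounds a set
  of faces: modulo 2, boundaries form a subspace of the cycle space of the same cardinality. This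
  replaces the Jordan curve theorem. First, it yields a vertex of degree at most 5 with distinct
  neighbours: if there are parallel edges, a 2-cycle bounding a minimal number of faces is a disc
  whose interior vertices have average degree below 6, and parallel edges at an interior vertex
  would bound a smaller disc. Second, for four consecutive neighbours of such a vertex, the first
  and third or the second and fourth are not adjacent, as a triangle through the vertex separates.
  Hence a wheel can always be contracted while there are more than 3 vertices. The Euler
  characteristic of the result need not be followed through the intermediate maps: a rotation
  system all of whose faces are triangles is planar iff \<open>6 * V = A + 12\<close>, with \<open>A\<close> the number of
  arcs, and each operation removes 6 arcs per vertex lost.
\<close>

section \<open>Subset counting and cyclic permutations\<close>

text \<open>Two obstacles shape the proof. Averaging degrees yields a vertex of degree at most 5,
  but parallel edges may make some of its neighbours coincide, and then it is not the center of a
  wheel; hence the averaging is repeated inside a smallest 2-cycle. Moreover, deleting a vertex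
  usually destroys the triangulation, so the maps in between are only known to be connected loopfree
  rotation systems, and their face walks are computed arc by arc. Edge sets are sets of arcs closed
  under reversal, sets of faces are sets of arcs closed under \<open>face_succ\<close>; symmetric
  difference is addition over GF(2). With V vertices, E edges and F faces, the boundaries have
  dimension F - 1 and the even edge sets dimension E - V + 1, which agree by Euler's formula. For
  triangles 3 F = A and 2 E = A, so V - E + F = 2 becomes 6 V = A + 12.\<close>

lemma card_closed_subsets:
  assumes "finite A"
    and block: "\<And>x. x \<in> A \<Longrightarrow> x \<in> B x \<and> B x \<subseteq> A \<and> card (B x) = k"
    and same: "\<And>x y. x \<in> A \<Longrightarrow> y \<in> B x \<Longrightarrow> B y = B x"
  shows "k * card (B ` A) = card A"
    and "card {S. S \<subseteq> A \<and> (\<forall>x\<in>S. B x \<subseteq> S)} = 2 ^ card (B ` A)"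
proof -
  have un: "\<Union> (B ` A) = A" using block by blast
  have disj: "X \<inter> Y = {}" if "X \<in> B ` A" "Y \<in> B ` A" "X \<noteq> Y" for X Y
  proof (rule ccontr)
    assume "X \<inter> Y \<noteq> {}"
    then obtain z where z: "z \<in> X" "z \<in> Y" by blast
    obtain x y where "x \<in> A" "X = B x" "y \<in> A" "Y = B y" using \<open>X \<in> B ` A\<close> \<open>Y \<in> B ` A\<close> by blast
    then show False using same[of x z] same[of y z] z \<open>X \<noteq> Y\<close> by simp
  qed
  have "k * card (B ` A) = card (\<Union> (B ` A))"
  proof (rule card_partition)
    show "finite (B ` A)" "finite (\<Union> (B ` A))" using assms(1) unfolding un by auto
    show "card c = k" if "c \<in> B ` A" for c using that block by blast
  qed (rule disj)
  then show "k * card (B ` A) = card A" using un by simp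
  let ?C = "{S. S \<subseteq> A \<and> (\<forall>x\<in>S. B x \<subseteq> S)}"
  \<comment> \<open>Closed subsets are the unions of blocks, and a union determines its blocks. The
    blocks will be edges (k = 2) and triangles (k = 3).\<close>
  have "bij_betw Union (Pow (B ` A)) ?C"
  proof (rule bij_betw_imageI)
    show "inj_on Union (Pow (B ` A))"
    proof (rule inj_onI)
      have "P \<subseteq> Q" if PQ: "P \<subseteq> B ` A" "Q \<subseteq> B ` A" "\<Union> P = \<Union> Q" for P Q
      proof
        fix X assume "X \<in> P"
        then obtain x where x: "x \<in> A" "X = B x" using PQ(1) by blast
        then have "x \<in> \<Union> Q" using block \<open>X \<in> P\<close> PQ(3) by blast
        then obtain Y where "Y \<in> Q" "x \<in> Y" by blast
        then have "Y = X" using disj[of X Y] x block[of x] PQ(2) by blast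
        then show "X \<in> Q" using \<open>Y \<in> Q\<close> by simp
      qed
      then show "P = Q" if "P \<in> Pow (B ` A)" "Q \<in> Pow (B ` A)" "\<Union> P = \<Union> Q" for P Q
        using that by (metis PowD subset_antisym)
    qed
    show "Union ` Pow (B ` A) = ?C"
    proof (intro equalityI subsetI)
      fix S assume "S \<in> Union ` Pow (B ` A)"
      then obtain P where P: "P \<subseteq> B ` A" "S = \<Union> P" by blast
      have "B x \<subseteq> S" if xS: "x \<in> S" for x
      proof -
        obtain y where "y \<in> A" "B y \<in> P" "x \<in> B y" using xS P by blast
        then show ?thesis using same P by blast
      qed
      moreover have "S \<subseteq> A" using P un by blast
      ultimately show "S \<in> ?C" by blast
    next
      fix S assume "S \<in> ?C"
      then have "S = \<Union> (B ` S)" "B ` S \<subseteq> B ` A" using block by blast+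
      then show "S \<in> Union ` Pow (B ` A)" by blast
    qed
  qed
  then have "card (Pow (B ` A)) = card ?C" by (rule bij_betw_same_card)
  then show "card ?C = 2 ^ card (B ` A)" using assms(1) by (simp add: card_Pow)
qed

text \<open>Rank-nullity over GF(2), with cardinalities in place of dimensions: every nonempty fibre
  of \<phi> is a translate of the kernel.\<close>

lemma card_sym_diff_hom:
  fixes \<phi> :: "'a set \<Rightarrow> 'b set"
  assumes "finite X"
    and closed: "\<And>S T. S \<in> X \<Longrightarrow> T \<in> X \<Longrightarrow> sym_diff S T \<in> X"
    and hom: "\<And>S T. S \<in> X \<Longrightarrow> T \<in> X \<Longrightarrow> \<phi> (sym_diff S T) = sym_diff (\<phi> S) (\<phi> T)"
  shows "card X = card (\<phi> ` X) * card {S \<in> X. \<phi> S = {}}"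
proof -
  let ?K = "{S \<in> X. \<phi> S = {}}"
  have fiber: "card {S \<in> X. \<phi> S = y} = card ?K" if "y \<in> \<phi> ` X" for y
  proof -
    obtain T where T: "T \<in> X" "\<phi> T = y" using \<open>y \<in> \<phi> ` X\<close> by blast
    have invol: "sym_diff (sym_diff S T) T = S" for S by blast
    have "bij_betw (\<lambda>S. sym_diff S T) ?K {S \<in> X. \<phi> S = y}"
    proof (rule bij_betw_byWitness[where f' = "\<lambda>S. sym_diff S T"])
      show "(\<lambda>S. sym_diff S T) ` ?K \<subseteq> {S \<in> X. \<phi> S = y}"
        using T closed hom by auto
      show "(\<lambda>S. sym_diff S T) ` {S \<in> X. \<phi> S = y} \<subseteq> ?K"
        using T closed hom by auto
    qed (simp_all add: invol)
    then show ?thesis by (rule bij_betw_same_card[symmetric])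
  qed
  have "card X = (\<Sum>y\<in>\<phi> ` X. card {S \<in> X. \<phi> S = y})"
    using sum.image_gen[OF assms(1), of "\<lambda>_. 1::nat" \<phi>] by (simp only: card_eq_sum)
  also have "\<dots> = (\<Sum>y\<in>\<phi> ` X. card ?K)"
    by (rule sum.cong) (use fiber in auto)
  finally show ?thesis by simp
qed

lemma odd_card_sym_diff:
  assumes "finite A" "finite B"
  shows "odd (card (sym_diff A B)) \<longleftrightarrow> odd (card A) \<noteq> odd (card B)"
proof -
  have "card (sym_diff A B) = card (A - B) + card (B - A)"
    by (rule card_Un_disjoint) (use assms in auto)
  moreover have "card A = card (A - B) + card (A \<inter> B)"
    using card_Diff_subset_Int[of A B] card_mono[of A "A \<inter> B"] assms by simp
  moreover have "card B = card (B - A) + card (A \<inter> B)"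
    using card_Diff_subset_Int[of B A] card_mono[of B "A \<inter> B"] assms by (simp add: Int_commute)
  ultimately show ?thesis by presburger
qed

text \<open>The unit vectors span; this serves to show that a parity map is onto.\<close>

lemma Pow_if_sym_diff_closed:
  assumes "finite W" "{} \<in> F" "\<And>u. u \<in> W \<Longrightarrow> {u} \<in> F"
    and closed: "\<And>S T. S \<in> F \<Longrightarrow> T \<in> F \<Longrightarrow> sym_diff S T \<in> F"
  shows "Pow W \<subseteq> F"
proof
  fix U assume "U \<in> Pow W"
  then have "finite U" "U \<subseteq> W" using assms(1) finite_subset by auto
  then show "U \<in> F"
  proof (induction U rule: finite_induct)
    case (insert u U)
    then have "insert u U = sym_diff {u} U" by blast
    then show ?case using closed[of "{u}" U] assms(3)[of u] insert by simp
  qed (use assms in simp)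
qed

section \<open>Cyclic permutations: splicing two cycles and skipping elements\<close>

lemma cyclic_onI_closed:
  assumes "S \<noteq> {}" "\<And>s. s \<in> S \<Longrightarrow> f s \<in> S"
    and min: "\<And>X. X \<subseteq> S \<Longrightarrow> X \<noteq> {} \<Longrightarrow> (\<And>x. x \<in> X \<Longrightarrow> f x \<in> X) \<Longrightarrow> X = S"
  shows "cyclic_on f S"
proof -
  obtain s where s: "s \<in> S" using assms(1) by blast
  have "orbit f s \<subseteq> S"
  proof
    fix y assume "y \<in> orbit f s"
    then show "y \<in> S" by induct (use s assms(2) in auto)
  qed
  then have "orbit f s = S"
    by (rule min) (auto simp: orbit_nonempty intro: orbit.step)
  then show ?thesis using s by (auto simp: cyclic_on_def)
qed

lemma cyclic_on_closed_subset:
  assumes "cyclic_on f S" "x \<in> S" "x \<in> X" "\<And>y. y \<in> X \<inter> S \<Longrightarrow> f y \<in> X"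
  shows "S \<subseteq> X"
proof
  fix y assume "y \<in> S"
  then have "y \<in> orbit f x" using assms(1,2) by (auto simp: cyclic_on_alldef)
  then have "y \<in> X \<inter> S"
    by induct (use assms cyclic_on_inI[OF assms(1)] in auto)
  then show "y \<in> X" by blast
qed

text \<open>The step into \<open>a\<close> is redirected to \<open>b\<close> and vice versa, which
  joins the two cycles; this is the rotation at a merged vertex. Testing cyclicity on closed subsets
  avoids iterates of the new permutation.\<close>

lemma cyclic_on_transpose:
  assumes S: "cyclic_on f S" and T: "cyclic_on f T" and disj: "S \<inter> T = {}"
    and a: "a \<in> S" and b: "b \<in> T"
  shows "cyclic_on (transpose a b \<circ> f) (S \<union> T)"
proof (rule cyclic_onI_closed)
  show "S \<union> T \<noteq> {}" using a by blast
next
  fix s assume "s \<in> S \<union> T"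
  then show "(transpose a b \<circ> f) s \<in> S \<union> T"
    using a b cyclic_on_inI[OF S, of s] cyclic_on_inI[OF T, of s] by (auto simp: transpose_def)
next
  fix X assume X: "X \<subseteq> S \<union> T" "X \<noteq> {}" and cl: "\<And>x. x \<in> X \<Longrightarrow> (transpose a b \<circ> f) x \<in> X"
  have one: "S' \<subseteq> X" if S': "cyclic_on f S'" "x \<in> S'" "x \<in> X" and ok: "\<And>y. y \<in> X \<inter> S' \<Longrightarrow> f y \<in> X" for S' x
    by (rule cyclic_on_closed_subset[OF S' ok])
  have pred: "\<exists>y\<in>S'. f y = z" if S': "cyclic_on f S'" "z \<in> S'" for S' z
  proof -
    have "z \<in> orbit f z" using S' by (auto simp: cyclic_on_alldef)
    then show ?thesis
    proof cases
      case base then show ?thesis using S' by metis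
    next
      case (step y)
      then have "y \<in> S'" using S' by (simp add: cyclic_on_alldef)
      then show ?thesis using step by blast
    qed
  qed
  have ft: "f y \<in> X \<or> f y = a \<and> b \<in> X \<or> f y = b \<and> a \<in> X" if "y \<in> X" for y
    using cl[OF that] by (auto simp: transpose_def split: if_splits)
  have fa: "b \<in> X" if "y \<in> X" "f y = a" for y using cl[OF that(1)] that by simp
  have fb: "a \<in> X" if "y \<in> X" "f y = b" for y using cl[OF that(1)] that by simp
  have both: "X = S \<union> T" if "a \<in> X" "b \<in> X"
    using X one[OF S a that(1)] one[OF T b that(2)] ft that by blast
  obtain x where x: "x \<in> X" "x \<in> S \<union> T" using X by blast
  consider "a \<in> X" "b \<in> X" | "a \<in> X" "b \<notin> X" | "a \<notin> X" "b \<in> X" | "a \<notin> X" "b \<notin> X" by blast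
  then show "X = S \<union> T"
  proof cases
    case 2
    \<comment> \<open>All of \<open>S\<close> lies in \<open>X\<close>, in particular the
      predecessor of \<open>a\<close>, which is now sent to \<open>b\<close>; this contradicts
      \<open>b \<notin> X\<close>.\<close>
    have "S \<subseteq> X" using one[OF S a 2(1)] ft fa 2 disj b cyclic_on_inI[OF S] by blast
    then show ?thesis using pred[OF S a] fa 2 by blast
  next
    case 3
    have "T \<subseteq> X" using one[OF T b 3(2)] ft fb 3 disj a cyclic_on_inI[OF T] by blast
    then show ?thesis using pred[OF T b] fb 3 by blast
  next
    case 4
    then have "f y \<in> X" if "y \<in> X" for y using ft that by blast
    then have "S \<subseteq> X \<or> T \<subseteq> X" using one[OF S] one[OF T] x by blast
    then show ?thesis using a b 4 by blast
  qed (use both in blast)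
qed

text \<open>Neither kind of deletion removes two successive arcs after a remaining one (the
  \<open>gap\<close> facts below), so the \<open>LEAST\<close> in \<open>next_in\<close> is 1 or
  2.\<close>

lemma next_in_eq:
  assumes "x \<in> S" "f x \<in> S \<or> f (f x) \<in> S"
  shows "next_in f S x = (if f x \<in> S then f x else f (f x))"
proof (cases "f x \<in> S")
  case True
  then have "(LEAST n. 0 < n \<and> (f ^^ n) x \<in> S) = 1"
    by (intro Least_equality) auto
  then show ?thesis using True assms(1) by (simp add: next_in_def)
next
  case False
  then have "(LEAST n. 0 < n \<and> (f ^^ n) x \<in> S) = Suc (Suc 0)"
  proof (intro Least_equality)
    fix n assume n: "0 < n \<and> (f ^^ n) x \<in> S"
    then have "n \<noteq> 1" using False by auto
    then show "Suc (Suc 0) \<le> n" using n by linarith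
  qed (use assms False in auto)
  then show ?thesis using False assms(1) by (simp add: next_in_def)
qed

lemma next_in_permutes:
  assumes "f permutes A" "finite S" "\<And>x. x \<in> S \<Longrightarrow> f x \<in> S \<or> f (f x) \<in> S"
  shows "next_in f S permutes S"
proof (rule bij_imp_permutes)
  have inj: "f x = f y \<longleftrightarrow> x = y" for x y
    using permutes_inj[OF assms(1)] by (simp add: inj_eq)
  have "inj_on (next_in f S) S"
    by (rule inj_onI) (auto simp: next_in_eq assms(3) inj split: if_splits)
  moreover have "next_in f S ` S \<subseteq> S"
    using assms(3) by (auto simp: next_in_eq)
  ultimately show "bij_betw (next_in f S) S S"
    using assms(2) by (simp add: bij_betw_def endo_inj_surj)
qed (simp add: next_in_def)

lemma cyclic_on_next_in:
  assumes "cyclic_on f R" "R \<inter> S \<noteq> {}" "\<And>x. x \<in> S \<Longrightarrow> f x \<in> S \<or> f (f x) \<in> S"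
  shows "cyclic_on (next_in f S) (R \<inter> S)"
proof (rule cyclic_onI_closed)
  show "R \<inter> S \<noteq> {}" by fact
  show "next_in f S s \<in> R \<inter> S" if "s \<in> R \<inter> S" for s
    using that assms(3)[of s] cyclic_on_inI[OF assms(1)] by (auto simp: next_in_eq)
next
  fix X assume X: "X \<subseteq> R \<inter> S" "X \<noteq> {}" and cl: "\<And>x. x \<in> X \<Longrightarrow> next_in f S x \<in> X"
  \<comment> \<open>Putting the skipped elements back turns a set closed under
    \<open>next_in f S\<close> into one closed under \<open>f\<close> on \<open>R\<close>, which
    must contain \<open>R\<close>.\<close>
  let ?Y = "X \<union> {f x | x. x \<in> X \<and> f x \<notin> S}"
  obtain x where x: "x \<in> X" using X by blast
  have "R \<subseteq> ?Y"
  proof (rule cyclic_on_closed_subset[OF assms(1)])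
    show "x \<in> R" "x \<in> ?Y" using x X by auto
    fix y assume "y \<in> ?Y \<inter> R"
    then consider "y \<in> X" | z where "z \<in> X" "f z \<notin> S" "y = f z" by blast
    then show "f y \<in> ?Y"
    proof cases
      case 1
      then have "y \<in> S" using X by blast
      then have "f y \<in> S \<Longrightarrow> f y \<in> X" using cl[OF 1] assms(3)[of y] by (simp add: next_in_eq)
      then show ?thesis using 1 by blast
    next
      case 2
      then have "z \<in> S" using X by blast
      then have "f y \<in> X" using cl[of z] assms(3)[of z] 2 by (simp add: next_in_eq)
      then show ?thesis by blast
    qed
  qed
  then show "X = R \<inter> S" using X by blast
qed

section \<open>Boundaries modulo 2\<close>

text \<open>The loopfree version of \<open>plane_map\<close> with the Euler characteristic left
  open, so that it covers the maps between two triangulations.\<close>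

locale rotation_map =
  fin_digraph "skel M" + bidirected_digraph "skel M" "rev_arc M" + loopfree_digraph "skel M"
  for M :: "('v, 'e) comb_map" +
  assumes rot_permutes: "rot M permutes arcs (skel M)"
    and rot_cyclic: "\<And>v. v \<in> verts (skel M) \<Longrightarrow> out_arcs (skel M) v \<noteq> {} \<Longrightarrow>
          cyclic_on (rot M) (out_arcs (skel M) v)"
    and connected_skel: "connected (skel M)"
begin

abbreviation "V \<equiv> verts (skel M)"
abbreviation "darts \<equiv> arcs (skel M)"
abbreviation "rv \<equiv> rev_arc M"
abbreviation "rt \<equiv> rot M"
abbreviation "fs \<equiv> face_succ M"
abbreviation "org \<equiv> tail (skel M)"
abbreviation "dst \<equiv> head (skel M)"
abbreviation "out \<equiv> out_arcs (skel M)"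

lemma rv_in_iff [simp]: "rv x \<in> darts \<longleftrightarrow> x \<in> darts"
  by (metis arev_arev arev_in_arcs)

lemma rt_in_iff [simp]: "rt x \<in> darts \<longleftrightarrow> x \<in> darts"
  using rot_permutes by (rule permutes_in_image)

lemma fs_in_iff [simp]: "fs x \<in> darts \<longleftrightarrow> x \<in> darts"
  by (simp add: face_succ_def)

lemma fs_rv [simp]: "fs (rv x) = rt x"
  by (simp add: face_succ_def)

lemma rt_rv: "rt (rv x) = fs x"
  by (simp add: face_succ_def)

lemma rt_inj: "rt x = rt y \<longleftrightarrow> x = y"
  using permutes_inj[OF rot_permutes] by (simp add: inj_eq)

lemma fs_inj: "fs x = fs y \<longleftrightarrow> x = y"
  by (simp add: face_succ_def rt_inj arev_eq_iff)

lemma org_rt [simp]: "x \<in> darts \<Longrightarrow> org (rt x) = org x"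
  using cyclic_on_inI[OF rot_cyclic, of "org x" x] by fastforce

lemma org_fs [simp]: "x \<in> darts \<Longrightarrow> org (fs x) = dst x"
  by (simp add: face_succ_def)

lemma fs_neq: "x \<in> darts \<Longrightarrow> fs x \<noteq> x"
  using no_loops[of x] org_fs[of x] by metis

lemma rt_neq_rv: "x \<in> darts \<Longrightarrow> rt x \<noteq> rv x"
  using no_loops[of x] org_rt[of x] tail_arev[of x] by metis

lemma vertex_induct:
  assumes "v \<in> V" "w \<in> V" "P v" "\<And>x. x \<in> darts \<Longrightarrow> P (org x) \<Longrightarrow> P (dst x)"
  shows "P w"
proof -
  have "v \<rightarrow>\<^sup>*\<^bsub>skel M\<^esub> w"
    using symmetric_connected_imp_strongly_connected[OF sym_arcs connected_skel] assms(1,2)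
    by (auto simp: strongly_connected_def)
  then show ?thesis
    by (induct rule: reachable_induct) (use assms in auto)
qed

lemma out_subset:
  assumes "x \<in> darts" "x \<in> S" "\<And>y. y \<in> S \<Longrightarrow> y \<in> out (org x) \<Longrightarrow> rt y \<in> S"
  shows "out (org x) \<subseteq> S"
  by (rule cyclic_on_closed_subset[OF rot_cyclic, of _ x]) (use assms in auto)

lemma out_nonempty:
  assumes "v \<in> V" "2 \<le> card V"
  shows "out v \<noteq> {}"
proof
  assume none: "out v = {}"
  have "w = v" if "w \<in> V" for w
    by (rule vertex_induct[OF assms(1) that]) (use none in auto)
  then have "V \<subseteq> {v}" by blast
  then have "card V \<le> 1" using card_mono[of "{v}" V] by simp
  then show False using assms(2) by simp
qed

text \<open>Connectedness makes reversal and rotation together transitive on the arcs.\<close>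

lemma darts_subset:
  assumes "x \<in> darts" "x \<in> S" "\<And>y. y \<in> S \<Longrightarrow> y \<in> darts \<Longrightarrow> rv y \<in> S \<and> rt y \<in> S"
  shows "darts \<subseteq> S"
proof
  fix z assume z: "z \<in> darts"
  have sub: "out (org y) \<subseteq> S" if "y \<in> darts" "y \<in> S" for y
    by (rule out_subset) (use that assms(3) in auto)
  have "out (org z) \<subseteq> S"
  proof (rule vertex_induct[of "org x" "org z" "\<lambda>v. out v \<subseteq> S"])
    show "out (org x) \<subseteq> S" by (rule sub[OF assms(1,2)])
    fix y assume y: "y \<in> darts" "out (org y) \<subseteq> S"
    then have "rv y \<in> S" using assms(3)[of y] by auto
    then show "out (dst y) \<subseteq> S" using sub[of "rv y"] y(1) by simp
  qed (use assms z in auto)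
  then show "z \<in> S" using z by auto
qed

text \<open>The two arcs of an edge belong to the faces on its two sides. For a union
  \<open>S\<close> of faces these are therefore the edges with \<open>S\<close> on exactly one side,
  each present with both arcs.\<close>

definition bdry :: "'e set \<Rightarrow> 'e set" where
  "bdry S = {x \<in> darts. (x \<in> S) \<noteq> (rv x \<in> S)}"

lemma bdry_sym_diff: "bdry (sym_diff S T) = sym_diff (bdry S) (bdry T)"
  by (auto simp: bdry_def)

lemma sum_card_out:
  assumes "C \<subseteq> darts" "U \<subseteq> V"
  shows "(\<Sum>v\<in>U. card (C \<inter> out v)) = card {x \<in> C. org x \<in> U}"
proof -
  have "{x \<in> C. org x \<in> U} = (\<Union>v\<in>U. C \<inter> out v)" using assms by auto
  moreover have "card (\<Union>v\<in>U. C \<inter> out v) = (\<Sum>v\<in>U. card (C \<inter> out v))"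
    by (rule card_UN_disjoint) (use finite_subset[OF assms(2)] finite_subset[OF assms(1)] in auto)
  ultimately show ?thesis by simp
qed

lemma finite_subset_darts: "C \<subseteq> darts \<Longrightarrow> finite C"
  using finite_subset finite_arcs by blast

lemma card_rev_closed:
  assumes "D \<subseteq> darts" "\<And>x. x \<in> D \<Longrightarrow> rv x \<in> D"
  shows "even (card D)"
    and "card {C. C \<subseteq> D \<and> (\<forall>x\<in>C. rv x \<in> C)} = 2 ^ (card D div 2)"
proof -
  let ?B = "\<lambda>x. {x, rv x}"
  have neq: "rv x \<noteq> x" if "x \<in> D" for x using that assms(1) arev_dom by blast
  have B: "x \<in> D \<Longrightarrow> x \<in> ?B x \<and> ?B x \<subseteq> D \<and> card (?B x) = 2" for x
    using assms(2) neq[of x] by auto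
  have same: "x \<in> D \<Longrightarrow> y \<in> ?B x \<Longrightarrow> ?B y = ?B x" for x y by auto
  note fin = finite_subset_darts[OF assms(1)]
  have *: "2 * card (?B ` D) = card D" by (rule card_closed_subsets(1)[OF fin B same])
  then show "even (card D)" by presburger
  have "{C. C \<subseteq> D \<and> (\<forall>x\<in>C. rv x \<in> C)} = {C. C \<subseteq> D \<and> (\<forall>x\<in>C. ?B x \<subseteq> C)}" by auto
  also have "card \<dots> = 2 ^ card (?B ` D)" by (rule card_closed_subsets(2)[OF fin B same])
  also have "card (?B ` D) = card D div 2" using * by linarith
  finally show "card {C. C \<subseteq> D \<and> (\<forall>x\<in>C. rv x \<in> C)} = 2 ^ (card D div 2)" .
qed

text \<open>As \<open>rt x\<close> follows \<open>rv x\<close> on its face, membership in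
  \<open>S\<close> changes from \<open>x\<close> to \<open>rt x\<close> exactly when
  \<open>x\<close> is a boundary arc. A full turn around a vertex makes an even number of
  changes.\<close>

lemma even_bdry_out:
  assumes "S \<subseteq> darts" "\<And>x. x \<in> darts \<Longrightarrow> fs x \<in> S \<longleftrightarrow> x \<in> S" "v \<in> V"
  shows "even (card (bdry S \<inter> out v))"
proof -
  have rt_S: "rt x \<in> S \<longleftrightarrow> rv x \<in> S" if "x \<in> darts" for x
    using assms(2)[of "rv x"] that by simp
  let ?P = "{x \<in> out v. x \<in> S}" and ?Q = "{x \<in> out v. rt x \<in> S}"
  have "bij_betw rt ?Q ?P"
  proof (rule bij_betw_imageI)
    show "inj_on rt ?Q" by (rule inj_onI) (simp add: rt_inj)
    show "rt ` ?Q = ?P"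
    proof (intro equalityI subsetI)
      fix y assume y: "y \<in> ?P"
      obtain x where x: "y = rt x" using permutes_surj[OF rot_permutes] by (metis surjD)
      then have "x \<in> darts" using y by simp
      then show "y \<in> rt ` ?Q" using x y by auto
    qed auto
  qed
  then have "card ?P = card ?Q" by (rule bij_betw_same_card[symmetric])
  moreover have "bdry S \<inter> out v = sym_diff ?P ?Q"
    using rt_S by (auto simp: bdry_def)
  ultimately show ?thesis
    using odd_card_sym_diff[of ?P ?Q] finite_out_arcs[of v] by auto
qed

end

section \<open>Maps with triangular faces only\<close>

locale triangular_map = rotation_map M for M :: "('v, 'e) comb_map" +
  assumes fs3: "x \<in> arcs (skel M) \<Longrightarrow> face_succ M (face_succ M (face_succ M x)) = x"
begin

lemma face_eq: "x \<in> darts \<Longrightarrow> face M x = {x, fs x, fs (fs x)}"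
proof -
  assume x: "x \<in> darts"
  have "face M x = {(fs ^^ m) x |m. m < 3}"
    unfolding face_def by (rule orbit_altdef_bounded) (simp_all add: fs3[OF x] numeral_3_eq_3)
  also have "\<dots> = (\<lambda>m. (fs ^^ m) x) ` {..<3}" by auto
  also have "\<dots> = {x, fs x, fs (fs x)}" by (auto simp: numeral_3_eq_3 lessThan_Suc)
  finally show ?thesis .
qed

lemma fs_fs_neq: "x \<in> darts \<Longrightarrow> fs (fs x) \<noteq> x"
  using fs3[of x] fs_neq[of x] by metis

lemma card_face: "x \<in> darts \<Longrightarrow> card {x, fs x, fs (fs x)} = 3"
  using fs_neq[of x] fs_neq[of "fs x"] fs_fs_neq[of x] by auto

lemma card_face_closed:
  assumes "T \<subseteq> darts" "\<And>x. x \<in> T \<Longrightarrow> fs x \<in> T"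
  shows "3 dvd card T"
    and "card {S. S \<subseteq> T \<and> (\<forall>x\<in>S. fs x \<in> S)} = 2 ^ (card T div 3)"
proof -
  let ?B = "\<lambda>x. {x, fs x, fs (fs x)}"
  have B: "x \<in> T \<Longrightarrow> x \<in> ?B x \<and> ?B x \<subseteq> T \<and> card (?B x) = 3" for x
    using assms card_face[of x] by auto
  have same: "x \<in> T \<Longrightarrow> y \<in> ?B x \<Longrightarrow> ?B y = ?B x" for x y
    using fs3[of x] assms(1) by auto
  note fin = finite_subset_darts[OF assms(1)]
  have *: "3 * card (?B ` T) = card T" by (rule card_closed_subsets(1)[OF fin B same])
  then show "3 dvd card T" by (metis dvd_triv_left)
  have "{S. S \<subseteq> T \<and> (\<forall>x\<in>S. fs x \<in> S)} = {S. S \<subseteq> T \<and> (\<forall>x\<in>S. ?B x \<subseteq> S)}" by auto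
  also have "card \<dots> = 2 ^ card (?B ` T)" by (rule card_closed_subsets(2)[OF fin B same])
  also have "card (?B ` T) = card T div 3" using * by linarith
  finally show "card {S. S \<subseteq> T \<and> (\<forall>x\<in>S. fs x \<in> S)} = 2 ^ (card T div 3)" .
qed

lemma card_faces: "3 * card (faces M) = card darts"
proof -
  let ?B = "\<lambda>x. {x, fs x, fs (fs x)}"
  have "faces M = ?B ` darts" by (simp add: faces_def face_eq)
  moreover have "3 * card (?B ` darts) = card darts"
    by (rule card_closed_subsets(1)) (use card_face fs3 in auto)
  ultimately show ?thesis by simp
qed

lemma fs_closed_iff:
  assumes "\<And>x. x \<in> S \<Longrightarrow> fs x \<in> S" "x \<in> darts"
  shows "fs x \<in> S \<longleftrightarrow> x \<in> S"
  using assms fs3[of x] by metis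

lemma rt_closed_iff:
  assumes "\<And>x. x \<in> S \<Longrightarrow> fs x \<in> S" "x \<in> darts" "x \<notin> bdry S"
  shows "rt x \<in> S \<longleftrightarrow> x \<in> S"
  using fs_closed_iff[OF assms(1), of "rv x"] assms(2,3) by (auto simp: bdry_def)

text \<open>Turning around \<open>v\<close> crosses only arcs leaving \<open>v\<close>. This is how
  a vertex off a cycle is placed on one side of it.\<close>

lemma out_subset_or_disjoint:
  assumes "\<And>x. x \<in> S \<Longrightarrow> fs x \<in> S" "bdry S \<inter> out v = {}"
  shows "out v \<subseteq> S \<or> out v \<inter> S = {}"
proof (cases "out v \<inter> S = {}")
  case False
  then obtain x where x: "x \<in> out v" "x \<in> S" by blast
  have "rt y \<in> S" if "y \<in> S" "y \<in> out (org x)" for y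
  proof -
    have "y \<in> darts" "y \<notin> bdry S" using that x assms(2) by auto
    then show ?thesis using rt_closed_iff[OF assms(1), of y] that by blast
  qed
  then have "out (org x) \<subseteq> S" using x by (intro out_subset) auto
  then show ?thesis using x by auto
qed simp

text \<open>The kernel of the boundary map: without boundary arcs, membership spreads along
  \<open>rv\<close> and \<open>rt\<close> to all arcs.\<close>

lemma bdry_empty_cases:
  assumes "S \<subseteq> darts" "\<And>x. x \<in> S \<Longrightarrow> fs x \<in> S" "bdry S = {}"
  shows "S = {} \<or> S = darts"
proof (cases "S = {}")
  case False
  then obtain x where x: "x \<in> S" by blast
  have "rv y \<in> S \<and> rt y \<in> S" if "y \<in> S" "y \<in> darts" for y
  proof -
    have "y \<notin> bdry S" using assms(3) by simp
    then have "rv y \<in> S" using that unfolding bdry_def by blast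
    moreover have "rt y \<in> S" using rt_closed_iff[OF assms(2), of y] that assms(3) by blast
    ultimately show ?thesis ..
  qed
  then show ?thesis using darts_subset[of x S] x assms(1) by blast
qed simp

end

section \<open>Planarity: cycles bound sets of faces\<close>

locale triangulation = triangular_map M for M :: "('v, 'e) comb_map" +
  assumes card_arcs: "6 * card (verts (skel M)) = card (arcs (skel M)) + 12"
begin

text \<open>\<open>F\<close> holds the sets of faces, \<open>R\<close> the edge sets and
  \<open>Z\<close> the cycle space. Boundaries lie in \<open>Z\<close>, and there are as many of
  them as elements of \<open>Z\<close>, so they exhaust it.\<close>

lemma cycle_bounds:
  assumes V3: "3 \<le> card V"
    and C: "C \<subseteq> darts" "\<And>x. x \<in> C \<Longrightarrow> rv x \<in> C" "\<And>v. v \<in> V \<Longrightarrow> even (card (C \<inter> out v))"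
  obtains S where "S \<subseteq> darts" "\<And>x. x \<in> S \<Longrightarrow> fs x \<in> S" "bdry S = C"
proof -
  define F where "F = {S. S \<subseteq> darts \<and> (\<forall>x\<in>S. fs x \<in> S)}"
  define R where "R = {C. C \<subseteq> darts \<and> (\<forall>x\<in>C. rv x \<in> C)}"
  define Z where "Z = {C \<in> R. \<forall>v\<in>V. even (card (C \<inter> out v))}"
  have finF: "finite F" and finR: "finite R"
    unfolding F_def R_def by (auto intro: finite_subset[of _ "Pow darts"])
  then have finZ: "finite Z" by (simp add: Z_def)
  have cF: "card F = 2 ^ (card darts div 3)"
    unfolding F_def by (rule card_face_closed) auto
  have cR: "card R = 2 ^ (card darts div 2)"
    unfolding R_def by (rule card_rev_closed) auto
  have Fiff: "fs x \<in> S \<longleftrightarrow> x \<in> S" if "S \<in> F" "x \<in> darts" for S x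
    by (rule fs_closed_iff) (use that in \<open>auto simp: F_def\<close>)

  have bF: "bdry ` F \<subseteq> Z"
  proof
    fix D assume "D \<in> bdry ` F"
    then obtain S where S: "S \<in> F" "D = bdry S" by blast
    then have "S \<subseteq> darts" by (simp add: F_def)
    have "D \<in> R" using S by (auto simp: R_def bdry_def)
    moreover have "even (card (D \<inter> out v))" if "v \<in> V" for v
      using even_bdry_out[OF \<open>S \<subseteq> darts\<close> Fiff[OF S(1)] that] S(2) by simp
    ultimately show "D \<in> Z" by (simp add: Z_def)
  qed

  have "darts \<noteq> {}" using card_arcs V3 by auto
  have "card F = card (bdry ` F) * card {S \<in> F. bdry S = {}}"
  proof (rule card_sym_diff_hom[OF finF])
    fix S T assume "S \<in> F" "T \<in> F"
    then show "sym_diff S T \<in> F"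
      using Fiff[of S] Fiff[of T] by (auto simp: F_def)
  qed (rule bdry_sym_diff)
  moreover have "{S \<in> F. bdry S = {}} = {{}, darts}"
  proof (intro equalityI subsetI)
    fix S assume "S \<in> {S \<in> F. bdry S = {}}"
    then show "S \<in> {{}, darts}" using bdry_empty_cases[of S] unfolding F_def by blast
  qed (auto simp: F_def bdry_def)
  ultimately have c1: "card F = card (bdry ` F) * 2" using \<open>darts \<noteq> {}\<close> by simp

  \<comment> \<open>The degrees in an edge set have an even sum, so the parity at one vertex is
    determined by the others. Leaving out \<open>v0\<close> makes the parity map onto.\<close>
  obtain v0 where v0: "v0 \<in> V" using V3 by fastforce
  define W where "W = V - {v0}"
  define \<phi> where "\<phi> C = {v \<in> W. odd (card (C \<inter> out v))}" for C
  have hom: "\<phi> (sym_diff S T) = sym_diff (\<phi> S) (\<phi> T)" for S T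
  proof -
    have "odd (card (sym_diff S T \<inter> out v)) \<longleftrightarrow> odd (card (S \<inter> out v)) \<noteq> odd (card (T \<inter> out v))" for v
    proof -
      have "sym_diff S T \<inter> out v = sym_diff (S \<inter> out v) (T \<inter> out v)" by blast
      then show ?thesis using odd_card_sym_diff[of "S \<inter> out v" "T \<inter> out v"] finite_out_arcs[of v] by simp
    qed
    then show ?thesis by (auto simp: \<phi>_def)
  qed
  have clR: "sym_diff S T \<in> R" if "S \<in> R" "T \<in> R" for S T
    using that unfolding R_def by auto
  have "card R = card (\<phi> ` R) * card {C \<in> R. \<phi> C = {}}"
    by (rule card_sym_diff_hom[OF finR clR hom])
  moreover have "\<phi> ` R = Pow W"
  proof
    show "\<phi> ` R \<subseteq> Pow W" by (auto simp: \<phi>_def)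
    show "Pow W \<subseteq> \<phi> ` R"
    proof (rule Pow_if_sym_diff_closed)
      show "finite W" by (simp add: W_def)
      show e: "{} \<in> \<phi> ` R" by (rule image_eqI[of _ _ "{}"]) (auto simp: R_def \<phi>_def)
      show cl: "sym_diff S T \<in> \<phi> ` R" if "S \<in> \<phi> ` R" "T \<in> \<phi> ` R" for S T
        using that clR hom[symmetric] by auto
      fix u assume u: "u \<in> W"
      \<comment> \<open>Starting at \<open>v0\<close>, whose parity is not recorded, singletons are
        reached edge by edge: adding the edge of \<open>x\<close> turns \<open>{org x}\<close> into
        \<open>{dst x}\<close>.\<close>
      have "u \<in> W \<longrightarrow> {u} \<in> \<phi> ` R"
      proof (rule vertex_induct[of v0 u])
        fix x assume x: "x \<in> darts" and IH: "org x \<in> W \<longrightarrow> {org x} \<in> \<phi> ` R"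
        have ne: "rv x \<noteq> x" "org x \<noteq> dst x" using x no_loops arev_dom by auto
        have "\<phi> {x, rv x} = {org x, dst x} \<inter> W"
        proof -
          have "{x, rv x} \<inter> out v = (if v = org x then {x} else if v = dst x then {rv x} else {})" for v
            using x ne by auto
          then show ?thesis by (auto simp: \<phi>_def)
        qed
        moreover have "{x, rv x} \<in> R" using x by (auto simp: R_def)
        ultimately have e: "{org x, dst x} \<inter> W \<in> \<phi> ` R" by (metis imageI)
        show "dst x \<in> W \<longrightarrow> {dst x} \<in> \<phi> ` R"
        proof
          assume d: "dst x \<in> W"
          show "{dst x} \<in> \<phi> ` R"
          proof (cases "org x \<in> W")
            case True
            have "sym_diff ({org x, dst x} \<inter> W) {org x} = {dst x}" using ne d True by auto
            moreover have "{org x} \<in> \<phi> ` R" using IH True by blast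
            ultimately show ?thesis using cl[OF e, of "{org x}"] by simp
          next
            case False
            then have "{org x, dst x} \<inter> W = {dst x}" using d by auto
            then show ?thesis using e by simp
          qed
        qed
      qed (use v0 u W_def in auto)
      then show "{u} \<in> \<phi> ` R" using u by blast
    qed
  qed
  moreover have "{C \<in> R. \<phi> C = {}} = Z"
  proof -
    have "even (card (C \<inter> out v0))" if "C \<in> R" "\<phi> C = {}" for C
    proof -
      have "C \<subseteq> darts" using that by (simp add: R_def)
      have "(\<Sum>v\<in>V. card (C \<inter> out v)) = card {x \<in> C. org x \<in> V}"
        by (rule sum_card_out) (use \<open>C \<subseteq> darts\<close> in auto)
      also have "{x \<in> C. org x \<in> V} = C" using \<open>C \<subseteq> darts\<close> by auto
      finally have "even (\<Sum>v\<in>V. card (C \<inter> out v))"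
        using card_rev_closed(1)[of C] that by (simp add: R_def)
      moreover have "(\<Sum>v\<in>V. card (C \<inter> out v)) = card (C \<inter> out v0) + (\<Sum>v\<in>W. card (C \<inter> out v))"
        unfolding W_def by (rule sum.remove) (use v0 in auto)
      moreover have "even (\<Sum>v\<in>W. card (C \<inter> out v))"
        by (rule dvd_sum) (use that in \<open>auto simp: \<phi>_def\<close>)
      ultimately show ?thesis by simp
    qed
    then show ?thesis by (auto simp: Z_def \<phi>_def W_def)
  qed
  ultimately have c2: "card R = 2 ^ card W * card Z" by (simp add: card_Pow W_def)

  obtain f where f: "card darts = 3 * f" using card_face_closed(1)[of darts] by auto
  obtain e where e: "card darts = 2 * e" using card_rev_closed(1)[of darts] by auto
  have w: "Suc (card W) = card V" unfolding W_def using v0 by (metis card_Suc_Diff1 finite_verts)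
  \<comment> \<open>Euler's formula, as \<open>card W\<close> is one less than the number of
    vertices; it matches the exponents of the two counts.\<close>
  have "e + 1 = card W + f" using f e w card_arcs V3 by linarith
  have "2 ^ (e + 1) = 2 * card R" using cR e by simp
  also have "\<dots> = 2 ^ card W * (2 * card Z)" using c2 by simp
  finally have "2 ^ f = 2 * card Z" unfolding \<open>e + 1 = _\<close> power_add by simp
  then have "card Z = card (bdry ` F)" using c1 cF f by simp
  then have "bdry ` F = Z" using bF finZ by (simp add: card_subset_eq)
  moreover have "C \<in> Z" using C by (auto simp: Z_def R_def)
  ultimately obtain S where "S \<in> F" "bdry S = C" by blast
  then show thesis by (intro that) (auto simp: F_def)
qed

end

section \<open>Small vertices with distinct neighbours\<close>

context triangulation
begin

text \<open>\<open>T\<close> is one side of the 2-cycle formed by the edges of \<open>a\<close> and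
  \<open>b\<close>. Both sides qualify; minimizing \<open>card T\<close>, which is three times the
  number of faces, later picks the one to use.\<close>

definition disc :: "'e set \<Rightarrow> 'e \<Rightarrow> 'e \<Rightarrow> bool" where
  "disc T a b \<longleftrightarrow> T \<subseteq> darts \<and> (\<forall>x\<in>T. fs x \<in> T) \<and> a \<in> darts \<and> b \<in> darts \<and> a \<noteq> b \<and>
     org a = org b \<and> dst a = dst b \<and> bdry T = {a, b, rv a, rv b}"

lemma disc_exists:
  assumes "3 \<le> card V" and ab: "a \<in> darts" "b \<in> darts" "a \<noteq> b" "org a = org b" "dst a = dst b"
  shows "\<exists>T. disc T a b"
proof -
  let ?C = "{a, b, rv a, rv b}"
  have ne: "org b \<noteq> dst b" using ab no_loops by auto
  have "even (card (?C \<inter> out v))" for v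
  proof -
    have "?C \<inter> out v = (if v = org b then {a, b} else if v = dst b then {rv a, rv b} else {})"
      using ab ne by auto
    then show ?thesis using ab by (simp add: arev_eq_iff)
  qed
  moreover have "?C \<subseteq> darts" "\<And>x. x \<in> ?C \<Longrightarrow> rv x \<in> ?C" using ab by auto
  ultimately obtain S where "S \<subseteq> darts" "\<And>x. x \<in> S \<Longrightarrow> fs x \<in> S" "bdry S = ?C"
    using cycle_bounds[OF assms(1), of ?C thesis] by blast
  then show ?thesis using ab unfolding disc_def by blast
qed

lemma disc_complement:
  assumes "disc T a b"
  shows "disc (darts - T) a b"
proof -
  have "bdry (darts - T) = bdry T" by (auto simp: bdry_def)
  moreover have "fs x \<in> darts - T" if "x \<in> darts - T" for x
    using that fs_closed_iff[of T x] assms by (auto simp: disc_def)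
  ultimately show ?thesis using assms unfolding disc_def by auto
qed

text \<open>With k interior vertices, e interior edges and f triangles, Euler's formula suggests e +
  1 = k + f. Only e + 1 \<le> k + f is derived, by comparing the inner edge sets that are even at
  interior vertices with the boundaries restricted to the inside. Counting sides of triangles gives
  3 f = 2 e + 2, so 2 e < 6 k; this also forces k > 0.\<close>

lemma disc_interior_vertex:
  assumes V3: "3 \<le> card V" and T: "disc T a b"
  shows "\<exists>v\<in>V. v \<noteq> org a \<and> v \<noteq> dst a \<and> out v \<subseteq> T \<and> card (out v) < 6"
proof -
  define p q where "p = org a" and "q = dst a"
  have sub: "T \<subseteq> darts" and cl: "\<And>x. x \<in> T \<Longrightarrow> fs x \<in> T"
    and ab: "a \<in> darts" "b \<in> darts" "a \<noteq> b" "org a = p" "org b = p" "dst a = q" "dst b = q"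
    and bd: "bdry T = {a, b, rv a, rv b}"
    using T by (auto simp: disc_def p_def q_def)
  have pq: "p \<noteq> q" "p \<in> V" "q \<in> V" using ab no_loops by auto
  define I where "I = {v \<in> V. v \<noteq> p \<and> v \<noteq> q \<and> out v \<subseteq> T}"
  have IV: "I \<subseteq> V" "finite I" by (auto simp: I_def)
  have other: "out v \<inter> T = {}" if "v \<in> V" "v \<notin> I" "v \<noteq> p" "v \<noteq> q" for v
  proof -
    have "bdry T \<inter> out v = {}" using bd ab that(3,4) by auto
    then have "out v \<subseteq> T \<or> out v \<inter> T = {}" using out_subset_or_disjoint[of T v] cl by blast
    then show ?thesis using that by (auto simp: I_def)
  qed
  define D where "D = {x \<in> T. rv x \<in> T}"
  have Dsub: "D \<subseteq> darts" "D \<subseteq> T" and Drv: "\<And>x. x \<in> D \<Longrightarrow> rv x \<in> D"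
    using sub by (auto simp: D_def)
  have DI: "x \<in> D" if "v \<in> I" "x \<in> out v" for v x
  proof -
    have "x \<in> T" "rt x \<in> T" "x \<in> darts" using that by (auto simp: I_def)
    then show ?thesis using fs_closed_iff[OF cl, of "rv x"] by (simp add: D_def)
  qed
  define R where "R = {C. C \<subseteq> D \<and> (\<forall>x\<in>C. rv x \<in> C)}"
  define Z where "Z = {C \<in> R. \<forall>v\<in>I. even (card (C \<inter> out v))}"
  define F where "F = {S. S \<subseteq> T \<and> (\<forall>x\<in>S. fs x \<in> S)}"
  have finT: "finite T" and finD: "finite D" using finite_subset_darts sub Dsub by auto
  have finR: "finite R" unfolding R_def by (rule finite_subset[of _ "Pow D"]) (use finD in auto)
  have finF: "finite F" unfolding F_def by (rule finite_subset[of _ "Pow T"]) (use finT in auto)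
  have cR: "card R = 2 ^ (card D div 2)"
    unfolding R_def by (rule card_rev_closed[OF Dsub(1) Drv])
  have cF: "card F = 2 ^ (card T div 3)"
    unfolding F_def by (rule card_face_closed[OF sub cl])

  define \<phi> where "\<phi> C = {v \<in> I. odd (card (C \<inter> out v))}" for C
  have hom: "\<phi> (sym_diff S S') = sym_diff (\<phi> S) (\<phi> S')" for S S'
  proof -
    have "odd (card (sym_diff S S' \<inter> out v)) \<longleftrightarrow> odd (card (S \<inter> out v)) \<noteq> odd (card (S' \<inter> out v))" for v
    proof -
      have "sym_diff S S' \<inter> out v = sym_diff (S \<inter> out v) (S' \<inter> out v)" by blast
      then show ?thesis using odd_card_sym_diff[of "S \<inter> out v" "S' \<inter> out v"] finite_out_arcs[of v] by simp
    qed
    then show ?thesis by (auto simp: \<phi>_def)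
  qed
  have clR: "sym_diff S S' \<in> R" if "S \<in> R" "S' \<in> R" for S S'
    using that unfolding R_def by auto
  have "card R = card (\<phi> ` R) * card {C \<in> R. \<phi> C = {}}"
    by (rule card_sym_diff_hom[OF finR clR hom])
  moreover have "{C \<in> R. \<phi> C = {}} = Z" by (auto simp: Z_def \<phi>_def)
  moreover have "card (\<phi> ` R) \<le> 2 ^ card I"
    using card_mono[of "Pow I" "\<phi> ` R"] IV by (auto simp: \<phi>_def card_Pow)
  ultimately have le1: "card R \<le> 2 ^ card I * card Z" by simp

  define \<psi> where "\<psi> S = bdry S \<inter> D" for S
  have "card F = card (\<psi> ` F) * card {S \<in> F. \<psi> S = {}}"
  proof (rule card_sym_diff_hom[OF finF])
    fix S S' assume S: "S \<in> F" "S' \<in> F"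
    have "fs x \<in> S \<longleftrightarrow> x \<in> S" if "S \<in> F" "x \<in> T" for S x
      by (rule fs_closed_iff) (use that sub in \<open>auto simp: F_def\<close>)
    from this[OF S(1)] this[OF S(2)] show "sym_diff S S' \<in> F"
      using S by (auto simp: F_def)
    show "\<psi> (sym_diff S S') = sym_diff (\<psi> S) (\<psi> S')"
      unfolding \<psi>_def bdry_sym_diff by blast
  qed
  \<comment> \<open>Both \<open>{}\<close> and \<open>T\<close> have no boundary inside. This factor
    2 is the 1 in e + 1.\<close>
  moreover have "2 \<le> card {S \<in> F. \<psi> S = {}}"
  proof -
    have "a \<in> bdry T" using bd by simp
    then have "T \<noteq> {}" by (auto simp: bdry_def)
    then have "card {{}, T} = 2" by auto
    moreover have "{{}, T} \<subseteq> {S \<in> F. \<psi> S = {}}"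
      using cl by (auto simp: F_def \<psi>_def bdry_def D_def)
    ultimately show ?thesis using card_mono[of "{S \<in> F. \<psi> S = {}}" "{{}, T}"] finF by simp
  qed
  ultimately have le2: "card (\<psi> ` F) * 2 \<le> card F" by simp

  have aD: "a \<notin> D" "rv a \<notin> D" using bd by (auto simp: bdry_def D_def)
  have "Z \<subseteq> \<psi> ` F"
  proof
    fix C assume C: "C \<in> Z"
    then have CD: "C \<subseteq> D" and Crv: "\<And>x. x \<in> C \<Longrightarrow> rv x \<in> C"
      and Cev: "\<And>v. v \<in> I \<Longrightarrow> even (card (C \<inter> out v))"
      by (auto simp: Z_def R_def)
    have Cdarts: "C \<subseteq> darts" using CD Dsub by blast
    have Cev': "even (card (C \<inter> out v))" if "v \<in> V" "v \<noteq> p" "v \<noteq> q" for v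
    proof (cases "v \<in> I")
      case False
      then have "C \<inter> out v = {}" using other[OF that(1)] that CD Dsub by blast
      then show ?thesis by simp
    qed (rule Cev)
    \<comment> \<open>Handshake: all other degrees in \<open>C\<close> are even, so those at
      \<open>p\<close> and \<open>q\<close> have the same parity.\<close>
    let ?rest = "\<Sum>v\<in>V - {p} - {q}. card (C \<inter> out v)"
    have "{x \<in> C. org x \<in> V} = C" using Cdarts by auto
    then have "card C = (\<Sum>v\<in>V. card (C \<inter> out v))"
      using sum_card_out[of C V] Cdarts by simp
    also have "\<dots> = card (C \<inter> out p) + (card (C \<inter> out q) + ?rest)"
      using pq sum.remove[of V p "\<lambda>v. card (C \<inter> out v)"]
        sum.remove[of "V - {p}" q "\<lambda>v. card (C \<inter> out v)"] by simp
    finally have "card C = card (C \<inter> out p) + (card (C \<inter> out q) + ?rest)" .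
    moreover have "even (card C)" using Crv Cdarts by (intro card_rev_closed(1))
    moreover have "even ?rest" by (rule dvd_sum) (use Cev' in auto)
    ultimately have pq_ev: "even (card (C \<inter> out p)) \<longleftrightarrow> even (card (C \<inter> out q))"
      by presburger
    have "\<exists>S. S \<subseteq> darts \<and> (\<forall>x\<in>S. fs x \<in> S) \<and> bdry S \<inter> D = C"
    proof (cases "even (card (C \<inter> out p))")
      case True
      then have "even (card (C \<inter> out v))" if "v \<in> V" for v using Cev'[OF that] pq_ev by blast
      then obtain S where "S \<subseteq> darts" "\<And>x. x \<in> S \<Longrightarrow> fs x \<in> S" "bdry S = C"
        using cycle_bounds[OF V3 Cdarts Crv] by blast
      then show ?thesis using CD by blast
    next
      case False
      \<comment> \<open>\<open>C\<close> is odd precisely at \<open>p\<close> and \<open>q\<close>.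
        The boundary edge \<open>a\<close> repairs both parities and disappears again on restriction
        to \<open>D\<close>.\<close>
      let ?C = "insert a (insert (rv a) C)"
      have aC: "a \<notin> C" "rv a \<notin> C" using aD CD by auto
      have fin: "finite (C \<inter> out v)" for v by (simp add: finite_out_arcs)
      have ev: "even (card (?C \<inter> out v))" if "v \<in> V" for v
      proof -
        consider "v = p" | "v = q" | "v \<noteq> p" "v \<noteq> q" by blast
        then show ?thesis
        proof cases
          case 1
          then have "?C \<inter> out v = insert a (C \<inter> out p)" using ab pq by auto
          then show ?thesis using False aC fin[of p] by simp
        next
          case 2
          then have "?C \<inter> out v = insert (rv a) (C \<inter> out q)" using ab pq by auto
          then show ?thesis using False aC fin[of q] pq_ev by simp
        next
          case 3
          then have "?C \<inter> out v = C \<inter> out v" using ab by auto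
          then show ?thesis using Cev'[OF that] 3 by simp
        qed
      qed
      have "?C \<subseteq> darts" "\<And>x. x \<in> ?C \<Longrightarrow> rv x \<in> ?C" using Cdarts ab Crv by auto
      then obtain S where S: "S \<subseteq> darts" "\<And>x. x \<in> S \<Longrightarrow> fs x \<in> S" "bdry S = ?C"
        using cycle_bounds[OF V3 _ _ ev] by blast
      moreover have "?C \<inter> D = C" using CD aD by blast
      ultimately show ?thesis by (intro exI[of _ S]) simp
    qed
    then obtain S where S: "S \<subseteq> darts" "\<forall>x\<in>S. fs x \<in> S" "bdry S \<inter> D = C" by blast
    \<comment> \<open>Inner edges have both arcs in \<open>T\<close>, so cutting \<open>S\<close>
      down to \<open>T\<close> leaves its boundary inside unchanged.\<close>
    have "\<psi> (S \<inter> T) = C" unfolding S(3)[symmetric] by (auto simp: \<psi>_def bdry_def D_def)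
    moreover have "S \<inter> T \<in> F" using S(2) cl by (auto simp: F_def)
    ultimately show "C \<in> \<psi> ` F" by blast
  qed
  then have le3: "card Z \<le> card (\<psi> ` F)" using finF by (simp add: card_mono)

  obtain f where f: "card T = 3 * f" using card_face_closed(1)[OF sub cl] by (auto elim: dvdE)
  obtain e where e: "card D = 2 * e" using card_rev_closed(1)[OF Dsub(1) Drv] by (auto elim: evenE)
  have "2 ^ e \<le> 2 ^ card I * card Z" using le1 cR e by simp
  also have "\<dots> \<le> 2 ^ card I * card (\<psi> ` F)" using le3 by simp
  finally have "2 ^ (e + 1) \<le> 2 ^ card I * (card (\<psi> ` F) * 2)" by simp
  also have "\<dots> \<le> 2 ^ card I * 2 ^ f" using le2 cF f by simp
  finally have "(2::nat) ^ (e + 1) \<le> 2 ^ (card I + f)" by (simp add: power_add)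
  then have ekf: "e + 1 \<le> card I + f" by (rule power_le_imp_le_exp[rotated]) simp

  \<comment> \<open>Each of the two boundary edges has exactly one arc in \<open>T\<close>, which
    accounts for the 2 in 3 f = 2 e + 2.\<close>
  have "T - D = {if a \<in> T then a else rv a, if b \<in> T then b else rv b}"
  proof -
    have x: "x \<in> T - D \<longleftrightarrow> x \<in> T \<and> x \<in> {a, b, rv a, rv b}" for x
      unfolding bd[symmetric] using sub by (auto simp: bdry_def D_def)
    have "(a \<in> T) \<noteq> (rv a \<in> T)" "(b \<in> T) \<noteq> (rv b \<in> T)"
      using bd unfolding bdry_def by blast+
    then show ?thesis using x by (intro set_eqI) (auto split: if_splits)
  qed
  moreover have "rv a \<noteq> b" "a \<noteq> rv b" "rv a \<noteq> rv b"
    using ab pq tail_arev[of a] tail_arev[of b] by (auto simp: arev_eq_iff)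
  ultimately have "card (T - D) = 2" using ab by auto
  moreover have "card T = card D + card (T - D)"
    using Dsub finT by (metis card_Diff_subset card_mono finD le_add_diff_inverse)
  ultimately have "3 * f = 2 * e + 2" using e f by simp
  then have small: "2 * e < 6 * card I" using ekf by linarith

  have "darts \<inter> out v = out v" for v by auto
  then have "(\<Sum>v\<in>I. card (out v)) = (\<Sum>v\<in>I. card (darts \<inter> out v))" by simp
  also have "\<dots> = card {x \<in> darts. org x \<in> I}"
    by (rule sum_card_out) (use IV in auto)
  also have "\<dots> \<le> card D" by (rule card_mono) (use finD DI in auto)
  finally have "(\<Sum>v\<in>I. card (out v)) < 6 * card I" using e small by simp
  then have "\<exists>v\<in>I. card (out v) < 6"
    using sum_bounded_below[of I 6 "\<lambda>v. card (out v)"] by (force simp: not_less)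
  then show ?thesis by (auto simp: I_def p_def q_def)
qed

text \<open>One end \<open>y\<close> of the old 2-cycle is off the new one. Take the side of the new
  cycle that avoids \<open>y\<close>: both old boundary edges end at \<open>y\<close>, so they have
  that side on neither of their sides. The new edges start at the interior vertex \<open>v\<close>,
  so they have \<open>T\<close> on both sides. Hence the intersection with \<open>T\<close> has
  exactly the new cycle as boundary.\<close>

lemma disc_shrink:
  assumes V3: "3 \<le> card V" and T: "disc T a b"
    and v: "v \<noteq> org a" "v \<noteq> dst a" "out v \<subseteq> T"
    and cd: "c \<in> out v" "d \<in> out v" "c \<noteq> d" "dst c = dst d"
  shows "\<exists>T'\<subset>T. disc T' c d"
proof -
  have sub: "T \<subseteq> darts" and cl: "\<And>x. x \<in> T \<Longrightarrow> fs x \<in> T"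
    and ab: "a \<in> darts" "b \<in> darts" "org b = org a" "dst b = dst a"
    and bd: "bdry T = {a, b, rv a, rv b}"
    using T by (auto simp: disc_def)
  have "org a \<noteq> dst a" using ab no_loops by auto
  define y where "y = (if dst c = org a then dst a else org a)"
  have y: "y = org a \<or> y = dst a" "y \<noteq> dst c" "y \<noteq> v"
    using v \<open>org a \<noteq> dst a\<close> by (auto simp: y_def)
  obtain T0 where T0: "disc T0 c d" using disc_exists[OF V3, of c d] cd by auto
  have "out y \<inter> T0 = {} \<or> out y \<subseteq> T0"
  proof -
    have "bdry T0 \<inter> out y = {}" using T0 y cd by (auto simp: disc_def)
    then show ?thesis using out_subset_or_disjoint[of T0 y] T0 by (auto simp: disc_def)
  qed
  then obtain T1 where T1: "disc T1 c d" "out y \<inter> T1 = {}"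
    using T0 disc_complement[OF T0] by blast
  have bd1: "bdry T1 = {c, d, rv c, rv d}" using T1 by (simp add: disc_def)
  have off: "z \<notin> T1 \<and> rv z \<notin> T1" if z: "z \<in> bdry T" for z
  proof -
    have "z \<in> out y \<or> rv z \<in> out y" using z y(1) ab unfolding bd by auto
    moreover have "w \<notin> T1 \<and> rv w \<notin> T1" if w: "w \<in> out y" for w
    proof -
      have "w \<notin> bdry T1" using w y cd unfolding bd1 by auto
      then show ?thesis using w T1(2) unfolding bdry_def by auto
    qed
    ultimately show ?thesis by fastforce
  qed
  have inT: "x \<in> T \<and> rv x \<in> T" if x: "x \<in> {c, d, rv c, rv d}" for x
  proof -
    have "w \<in> T \<and> rv w \<in> T" if "w \<in> out v" for w
    proof -
      have "w \<in> T" "rt w \<in> T" "w \<in> darts" using that v(3) by auto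
      then show ?thesis using fs_closed_iff[OF cl, of "rv w"] by simp
    qed
    then show ?thesis using x cd by auto
  qed
  let ?T = "T \<inter> T1"
  have "bdry ?T = bdry T1"
  proof (rule set_eqI)
    fix z
    consider "z \<in> bdry T1" | "z \<notin> bdry T1" "z \<in> bdry T" | "z \<notin> bdry T1" "z \<notin> bdry T" by blast
    then show "z \<in> bdry ?T \<longleftrightarrow> z \<in> bdry T1"
    proof cases
      case 1
      then show ?thesis using inT[of z] unfolding bd1[symmetric] by (auto simp: bdry_def)
    next
      case 2
      then show ?thesis using off[of z] by (auto simp: bdry_def)
    qed (auto simp: bdry_def)
  qed
  then have "disc ?T c d" using T1(1) sub cl by (auto simp: disc_def)
  moreover have "?T \<noteq> T"
  proof -
    have "a \<in> bdry T" by (simp add: bd)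
    then have "a \<notin> T1 \<and> rv a \<notin> T1" "a \<in> T \<or> rv a \<in> T" using off[of a] by (auto simp: bdry_def)
    then show ?thesis by blast
  qed
  ultimately show ?thesis by blast
qed

lemma exists_small_simple_vertex:
  assumes V3: "3 \<le> card V"
  shows "\<exists>v\<in>V. card (out v) < 6 \<and> inj_on dst (out v)"
proof (cases "\<exists>T a b. disc T a b")
  case True
  define P where "P n \<longleftrightarrow> (\<exists>T a b. disc T a b \<and> card T = n)" for n
  have "\<exists>n. P n" using True by (auto simp: P_def)
  then have "P (LEAST n. P n)" by (rule LeastI_ex)
  then obtain T a b where T: "disc T a b" "card T = (LEAST n. P n)" unfolding P_def by blast
  obtain v where v: "v \<in> V" "v \<noteq> org a" "v \<noteq> dst a" "out v \<subseteq> T" "card (out v) < 6"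
    using disc_interior_vertex[OF V3 T(1)] by blast
  have "inj_on dst (out v)"
  proof (rule inj_onI, rule ccontr)
    fix c d assume cd: "c \<in> out v" "d \<in> out v" "dst c = dst d" "c \<noteq> d"
    obtain T' where T': "T' \<subset> T" "disc T' c d"
      using disc_shrink[OF V3 T(1) v(2-4) cd(1,2,4,3)] by blast
    have "finite T" using T(1) finite_subset_darts by (simp add: disc_def)
    then have "card T' < card T" using T'(1) by (rule psubset_card_mono)
    moreover have "P (card T')" using T'(2) by (auto simp: P_def)
    ultimately show False using T(2) not_less_Least by metis
  qed
  then show ?thesis using v by blast
next
  case False
  have inj: "inj_on dst (out v)" for v
  proof (rule inj_onI, rule ccontr)
    fix c d assume "c \<in> out v" "d \<in> out v" "dst c = dst d" "c \<noteq> d"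
    then show False using disc_exists[OF V3, of c d] False by auto
  qed
  have "darts \<inter> out v = out v" for v by auto
  then have "(\<Sum>v\<in>V. card (out v)) = (\<Sum>v\<in>V. card (darts \<inter> out v))" by simp
  also have "\<dots> = card {x \<in> darts. org x \<in> V}" by (rule sum_card_out) auto
  also have "\<dots> \<le> card darts" by (rule card_mono) auto
  finally have "(\<Sum>v\<in>V. card (out v)) < 6 * card V" using card_arcs by simp
  then have "\<exists>v\<in>V. card (out v) < 6"
    using sum_bounded_below[of V 6 "\<lambda>v. card (out v)"] by (force simp: not_less)
  then show ?thesis using inj by blast
qed

section \<open>Separation by a triangle through a vertex\<close>

lemma adjacent_iff: "adjacent M u w \<longleftrightarrow> (\<exists>x\<in>darts. org x = u \<and> dst x = w)"
  by (auto simp: adjacent_def arcs_ends_conv)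

text \<open>If both chords \<open>e\<close> and \<open>g\<close> existed, the triangle of
  \<open>x\<close>, \<open>a3\<close> and \<open>e\<close> would have \<open>a2\<close> and
  \<open>a4\<close> on opposite sides, since turning from one to the other crosses just its edge
  \<open>a3\<close>. But \<open>g\<close> joins their far ends without meeting the triangle.\<close>

lemma alternate_neighbors_not_adjacent:
  assumes V3: "3 \<le> card V" and x: "x \<in> darts" and inj: "inj_on dst (out (org x))"
    and distinct: "distinct [x, rt x, rt (rt x), rt (rt (rt x))]"
  shows "\<not> adjacent M (dst x) (dst (rt (rt x))) \<or>
    \<not> adjacent M (dst (rt x)) (dst (rt (rt (rt x))))"
proof (rule ccontr)
  define v a2 a3 a4 where "v = org x" and "a2 = rt x" and "a3 = rt (rt x)" and "a4 = rt (rt (rt x))"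
  have in_v: "x \<in> out v" "a2 \<in> out v" "a3 \<in> out v" "a4 \<in> out v"
    using x by (auto simp: v_def a2_def a3_def a4_def)
  have dist: "distinct [x, a2, a3, a4]" using distinct by (simp add: a2_def a3_def a4_def)
  have dst: "distinct [v, dst x, dst a2, dst a3, dst a4]"
    using inj dist in_v no_loops unfolding v_def inj_on_def by (auto simp: v_def)
  assume "\<not> ?thesis"
  then obtain e g where e: "e \<in> darts" "org e = dst x" "dst e = dst a3"
    and g: "g \<in> darts" "org g = dst a2" "dst g = dst a4"
    by (auto simp: adjacent_iff a2_def a3_def a4_def)
  let ?C = "{x, a3, e, rv x, rv a3, rv e}"
  have ends: "org x = v" "org a3 = v" "a3 \<in> darts" using in_v by auto
  have "even (card (?C \<inter> out u))" for u
  proof -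
    have "?C \<inter> out u = (if u = v then {x, a3} else if u = dst x then {rv x, e}
        else if u = dst a3 then {rv a3, rv e} else {})"
      using x e ends dst by auto
    moreover have "rv x \<noteq> e" "rv a3 \<noteq> rv e"
      using e ends dst x head_arev[of x] by (auto simp: arev_eq_iff)
    ultimately show ?thesis using dist by auto
  qed
  moreover have "?C \<subseteq> darts" "\<And>y. y \<in> ?C \<Longrightarrow> rv y \<in> ?C" using x ends e by auto
  ultimately obtain T where T: "T \<subseteq> darts" "\<And>y. y \<in> T \<Longrightarrow> fs y \<in> T" "bdry T = ?C"
    using cycle_bounds[OF V3, of ?C thesis] by blast
  have across: "rv y \<in> T \<longleftrightarrow> y \<in> T" if "y \<in> darts" "y \<notin> ?C" for y
    using that unfolding T(3)[symmetric] bdry_def by blast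
  have a2: "a2 \<in> darts" "a2 \<notin> ?C" using in_v dist dst e ends x by auto
  have a4: "a4 \<in> darts" "a4 \<notin> ?C" using in_v dist dst e ends x by auto
  have gC: "g \<notin> ?C" using g dst e ends x by auto
  \<comment> \<open>Neither \<open>dst a2\<close> nor \<open>dst a4\<close> is a corner of the
    triangle, so all faces at each of them are on one side.\<close>
  have "out (dst a2) \<subseteq> T \<or> out (dst a2) \<inter> T = {}"
    by (rule out_subset_or_disjoint[OF T(2)]) (use T(3) x e ends dst in auto)
  moreover have "rv a2 \<in> out (dst a2)" "g \<in> out (dst a2)" using a2 g by auto
  ultimately have "rv a2 \<in> T \<longleftrightarrow> g \<in> T" by blast
  have "out (dst a4) \<subseteq> T \<or> out (dst a4) \<inter> T = {}"
    by (rule out_subset_or_disjoint[OF T(2)]) (use T(3) x e ends dst in auto)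
  moreover have "rv a4 \<in> out (dst a4)" "rv g \<in> out (dst a4)" using a4 g by auto
  ultimately have "rv a4 \<in> T \<longleftrightarrow> rv g \<in> T" by blast
  with \<open>rv a2 \<in> T \<longleftrightarrow> g \<in> T\<close> have same: "a2 \<in> T \<longleftrightarrow> a4 \<in> T"
    using across[OF a2] across[OF a4] across[OF g(1) gC] by blast
  have "a3 \<in> T \<longleftrightarrow> a2 \<in> T"
    using rt_closed_iff[OF T(2) a2(1)] a2(2) T(3) by (simp add: a2_def a3_def)
  moreover have "a4 \<in> T \<longleftrightarrow> rv a3 \<in> T"
    using fs_closed_iff[OF T(2), of "rv a3"] ends by (simp add: a3_def a4_def)
  moreover have "a3 \<in> bdry T" by (simp add: T(3))
  ultimately show False using same by (auto simp: bdry_def)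
qed

end

section \<open>Deletion of edges and identification of vertices\<close>

context rotation_map
begin

text \<open>One statement for all operations: \<open>r\<close> is the identity for deleting an edge,
  sends a deleted vertex to a neighbour, and sends the second of two identified vertices to the
  first.\<close>

lemma connected_image:
  assumes "sym_digraph H" "verts H = r ` V" "\<And>x. x \<in> darts \<Longrightarrow> r (org x) \<rightarrow>\<^sup>*\<^bsub>H\<^esub> r (dst x)"
  shows "connected H"
proof -
  interpret H: sym_digraph H by fact
  obtain v where v: "v \<in> V"
    using connected_skel by (auto simp: connected_conv)
  have *: "r v \<rightarrow>\<^sup>*\<^bsub>H\<^esub> r w" if "w \<in> V" for w
    by (rule vertex_induct[OF v that])
      (use v assms(2,3) in \<open>auto intro: H.reachable_trans\<close>)
  have "a \<rightarrow>\<^sup>*\<^bsub>H\<^esub> b" if "a \<in> verts H" "b \<in> verts H" for a b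
  proof -
    have "r v \<rightarrow>\<^sup>*\<^bsub>H\<^esub> a" "r v \<rightarrow>\<^sup>*\<^bsub>H\<^esub> b" using that * assms(2) by auto
    then show ?thesis using H.symmetric_reachable' H.reachable_trans by blast
  qed
  then show ?thesis
    using v assms(2) rtrancl_on_mono[of "arcs_ends H" "(arcs_ends H)\<^sup>s" "verts H" "verts H"]
    by (auto simp: connected_conv reachable_def symcl_def)
qed

lemma restrict_to_simps:
  "skel (restrict_to M H) = H" "rev_arc (restrict_to M H) = perm_restrict rv (arcs H)"
  "rot (restrict_to M H) = next_in rt (arcs H)"
  by (simp_all add: restrict_to_def)

text \<open>Shared by the deletion of edges and of vertices. As at most one arc is skipped at a
  time, the new face walk needs at most one extra rotation step.\<close>

lemma rotation_map_restrict_to: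
  assumes H: "arcs H \<subseteq> darts" "tail H = org" "head H = dst" "finite (verts H)"
    and wf: "\<And>x. x \<in> arcs H \<Longrightarrow> rv x \<in> arcs H" "\<And>x. x \<in> arcs H \<Longrightarrow> org x \<in> verts H"
    and gap: "\<And>x. x \<in> arcs H \<Longrightarrow> rt x \<in> arcs H \<or> rt (rt x) \<in> arcs H"
    and conn: "verts H = r ` V" "\<And>x. x \<in> darts \<Longrightarrow> r (org x) \<rightarrow>\<^sup>*\<^bsub>H\<^esub> r (dst x)"
  shows "rotation_map (restrict_to M H)"
    and "x \<in> arcs H \<Longrightarrow> face_succ (restrict_to M H) x = (if fs x \<in> arcs H then fs x else rt (fs x))"
proof -
  have fin: "finite (arcs H)" using H(1) by (rule finite_subset_darts)
  have dst_H: "dst x \<in> verts H" if "x \<in> arcs H" for x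
    using wf(2)[OF wf(1)[OF that]] that H(1) by auto
  interpret H: fin_digraph H
    by unfold_locales (use H wf dst_H fin in auto)
  interpret H: bidirected_digraph H "perm_restrict rv (arcs H)"
    by (rule H.bidirected_digraphI)
      (use H wf in \<open>auto simp: perm_restrict_simps arev_neq subset_iff\<close>)
  interpret H: loopfree_digraph H
    by unfold_locales (use H no_loops in auto)
  have out_H: "out_arcs H v = out v \<inter> arcs H" for v
    using H by auto
  have "cyclic_on (next_in rt (arcs H)) (out_arcs H v)" if v: "v \<in> verts H" "out_arcs H v \<noteq> {}" for v
  proof -
    obtain x where "x \<in> out v" using v out_H by blast
    then have "v \<in> V" by auto
    then show ?thesis using cyclic_on_next_in[OF rot_cyclic[of v] _ gap] v out_H[of v] by auto
  qed
  then show "rotation_map (restrict_to M H)"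
    unfolding rotation_map_def rotation_map_axioms_def restrict_to_simps
    using H.fin_digraph_axioms H.bidirected_digraph_axioms H.loopfree_digraph_axioms
      next_in_permutes[OF rot_permutes fin gap]
      connected_image[OF H.sym_digraph_axioms conn]
    by blast
  show "face_succ (restrict_to M H) x = (if fs x \<in> arcs H then fs x else rt (fs x))" if "x \<in> arcs H"
    using next_in_eq[of "rv x" "arcs H" rt] gap[of "rv x"] wf(1)[OF that] that
    by (simp add: face_succ_def restrict_to_simps perm_restrict_simps)
qed

lemma delete_edge_skel:
  "verts (skel (delete_edge M a)) = V" "arcs (skel (delete_edge M a)) = darts - {a, rv a}"
  "tail (skel (delete_edge M a)) = org" "head (skel (delete_edge M a)) = dst"
  by (auto simp: delete_edge_def restrict_to_simps pre_digraph.del_arc_def)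

text \<open>The digon \<open>a\<close>, \<open>b\<close> merges with the face beyond
  \<open>a\<close>, in whose walk \<open>b\<close> takes the place of \<open>rv a\<close>. The ends
  of \<open>a\<close> stay connected through \<open>b\<close>.\<close>

lemma rotation_map_delete_edge:
  assumes a: "a \<in> darts" "fs a = b" "fs b = a" "b \<noteq> rv a"
  shows "rotation_map (delete_edge M a)"
    and "card (arcs (skel (delete_edge M a))) + 2 = card darts"
    and "x \<in> darts - {a, rv a} \<Longrightarrow> rev_arc (delete_edge M a) x = rv x"
    and "x \<in> darts - {a, rv a} \<Longrightarrow> face_succ (delete_edge M a) x =
      (if fs x = a then fs (rv a) else if fs x = rv a then b else fs x)"
proof -
  define H where "H = pre_digraph.del_arc (pre_digraph.del_arc (skel M) a) (rv a)"
  have D: "delete_edge M a = restrict_to M H" by (simp add: delete_edge_def H_def)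
  have H: "verts H = V" "arcs H = darts - {a, rv a}" "tail H = org" "head H = dst"
    by (auto simp: H_def pre_digraph.del_arc_def)
  have b: "b \<in> darts" "b \<noteq> a" using a fs_in_iff[of a] fs_neq[of a] by auto
  have ends_b: "org b = dst a" "dst b = org a" using a b org_fs[of a] org_fs[of b] by auto
  have rt_ra: "rt (rv a) = b" using a(2) rt_rv[of a] by simp
  have rt_a: "rt a \<noteq> a" "rt a \<noteq> rv a"
    using rt_neq_rv[OF a(1)] fs_rv[of a] fs_inj[of "rv a" b] a by auto
  have wf: "rv x \<in> arcs H" if "x \<in> arcs H" for x
    using that unfolding H by (auto simp: arev_eq_iff)
  have gap: "rt x \<in> arcs H \<or> rt (rt x) \<in> arcs H" if "x \<in> arcs H" for x
    using that a b rt_a rt_ra unfolding H by auto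
  have bH: "b \<in> arcs H" "rv b \<in> arcs H" using wf b a(4) by (auto simp: H)
  have "fin_digraph H"
    by unfold_locales (use H in auto)
  then interpret H: fin_digraph H .
  interpret H: sym_digraph H
  proof
    show "symmetric H"
      unfolding symmetric_conv using wf H head_arev tail_arev by (metis DiffD1)
  qed
  have adj: "org x \<rightarrow>\<^sup>*\<^bsub>H\<^esub> dst x" if "x \<in> arcs H" for x
    using that H by (intro H.reachable_adjI) (auto simp: arcs_ends_conv)
  have conn: "id (org x) \<rightarrow>\<^sup>*\<^bsub>H\<^esub> id (dst x)" if x: "x \<in> darts" for x
  proof -
    consider "x \<in> arcs H" | "x = a" | "x = rv a" using x H by blast
    then show ?thesis
    proof cases
      case 2
      then show ?thesis using adj[OF bH(2)] ends_b b by simp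
    next
      case 3
      then show ?thesis using adj[OF bH(1)] ends_b a by simp
    qed (simp add: adj)
  qed
  have pre: "arcs H \<subseteq> darts" "finite (verts H)" "verts H = id ` V" "\<And>x. x \<in> arcs H \<Longrightarrow> org x \<in> verts H"
    using H by auto
  have R: "rotation_map (restrict_to M H)"
    "\<And>x. x \<in> arcs H \<Longrightarrow>
      face_succ (restrict_to M H) x = (if fs x \<in> arcs H then fs x else rt (fs x))"
    by (rule rotation_map_restrict_to[OF pre(1) H(3,4) pre(2) wf pre(4) gap pre(3) conn]; assumption)+
  show "rotation_map (delete_edge M a)" unfolding D by (rule R(1))
  have "card darts = card (arcs H) + card {a, rv a}"
    using card_Diff_subset[of "{a, rv a}" darts] card_mono[of darts "{a, rv a}"] a(1) H(2) by simp
  moreover have "card {a, rv a} = 2" using arev_neq[OF a(1)] by auto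
  ultimately show "card (arcs (skel (delete_edge M a))) + 2 = card darts"
    by (simp add: D restrict_to_simps)
  show "rev_arc (delete_edge M a) x = rv x" if "x \<in> darts - {a, rv a}"
    using that by (simp add: D restrict_to_simps H perm_restrict_simps)
  show "face_succ (delete_edge M a) x =
      (if fs x = a then fs (rv a) else if fs x = rv a then b else fs x)" if x: "x \<in> darts - {a, rv a}"
  proof -
    have xH: "x \<in> arcs H" using x H by simp
    have "fs x \<in> darts" using x by simp
    then show ?thesis unfolding D R(2)[OF xH] using rt_ra rt_rv[of "rv a"] H by (auto simp: arev_eq_iff)
  qed
qed

lemma digonI:
  assumes "a \<in> darts" "fs a = b" "fs b = a" "b \<noteq> rv a"
  shows "digon M a"
proof -
  have "face M a = {(fs ^^ m) a |m. m < 2}"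
    unfolding face_def by (rule orbit_altdef_bounded) (use assms in \<open>simp_all add: numeral_2_eq_2\<close>)
  also have "\<dots> = (\<lambda>m. (fs ^^ m) a) ` {..<2}" by auto
  also have "\<dots> = {a, b}" using assms(2) by (auto simp: numeral_2_eq_2 lessThan_Suc)
  finally show ?thesis using assms fs_neq[of a] by (auto simp: digon_def)
qed

text \<open>The triangle condition is imposed arc by arc because another digon may still be waiting
  to be merged.\<close>

lemma delete_edge_triangular:
  assumes a: "a \<in> darts" "fs a = b" "fs b = a" "b \<noteq> rv a"
    and tri: "fs (fs (fs (rv a))) = rv a"
    and x: "x \<in> darts - {a, rv a}" "x = b \<or> fs (fs (fs x)) = x"
  defines "g \<equiv> face_succ (delete_edge M a)"
  shows "g (g (g x)) = x"
proof -
  have g: "g y = (if fs y = a then fs (rv a) else if fs y = rv a then b else fs y)"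
    if "y \<in> darts - {a, rv a}" for y
    unfolding g_def by (rule rotation_map_delete_edge(4)[OF a that])
  \<comment> \<open>The triangle \<open>rv a\<close>, \<open>y\<close>, \<open>z\<close> becomes
    \<open>b\<close>, \<open>y\<close>, \<open>z\<close>.\<close>
  define y z where "y = fs (rv a)" and "z = fs (fs (rv a))"
  have ab: "b \<noteq> a" "b \<in> darts" using a fs_neq[of a] fs_in_iff[of a] by auto
  \<comment> \<open>The walk alternates between \<open>a\<close> and \<open>b\<close>, so three
    steps never return: neither lies on a triangle.\<close>
  have tri_ne: "w \<noteq> a \<and> w \<noteq> b" if "fs (fs (fs w)) = w" for w
    using that a ab by auto
  have ra: "rv a \<in> darts" using a by simp
  have yz: "y \<in> darts" "z \<in> darts" "fs y = z" "fs z = rv a" "y \<noteq> rv a" "z \<noteq> rv a"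
    "fs (fs (fs y)) = y" "fs (fs (fs z)) = z"
    using ra tri fs_neq[OF ra] fs_neq[of z] by (auto simp: y_def z_def)
  then have "y \<notin> {a, b}" "z \<notin> {a, b}" using tri_ne by blast+
  then have gy: "g y = z" and gz: "g z = b" and gb: "g b = y"
    using yz ab a g[of y] g[of z] g[of b] by (auto simp: y_def)
  show ?thesis
  proof (cases "x \<in> {b, y, z}")
    case True
    then show ?thesis using gy gz gb by auto
  next
    case False
    then have t: "fs (fs (fs x)) = x" using x by blast
    have in_d: "x \<in> darts" "fs x \<in> darts" "fs (fs x) \<in> darts" using x by auto
    have ne: "w \<notin> {a, b}" if "w \<in> {x, fs x, fs (fs x)}" for w
      using tri_ne[of w] that t by auto
    have "fs x \<noteq> rv a" "fs (fs x) \<noteq> rv a"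
      using False t yz(3,4) fs_inj[of z x] fs_inj[of y "fs (fs x)"] y_def by auto
    moreover have "x \<noteq> rv a" using x by blast
    ultimately have "g x = fs x" "g (fs x) = fs (fs x)" "g (fs (fs x)) = x"
      using g[of x] g[of "fs x"] g[of "fs (fs x)"] ne t in_d by auto
    then show ?thesis by simp
  qed
qed

section \<open>Identification of two vertices\<close>

lemma identify_simps:
  "skel (identify M a b) = \<lparr>verts = (\<lambda>x. if x = org b then org a else x) ` V, arcs = darts,
     tail = (\<lambda>x. if x = org b then org a else x) \<circ> org, head = (\<lambda>x. if x = org b then org a else x) \<circ> dst\<rparr>"
  "rev_arc (identify M a b) = rv" "rot (identify M a b) = transpose a b \<circ> rt"
  by (simp_all add: identify_def Let_def)

lemma face_succ_identify: "face_succ (identify M a b) x = transpose a b (fs x)"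
  by (simp add: face_succ_def identify_simps)

lemma card_verts_identify:
  assumes "a \<in> darts" "b \<in> darts" "org a \<noteq> org b"
  shows "card (verts (skel (identify M a b))) + 1 = card V"
proof -
  have "verts (skel (identify M a b)) = V - {org b}"
    using assms by (auto simp: identify_simps)
  then show ?thesis using assms card_Suc_Diff1[of V "org b"] by simp
qed

text \<open>Nonadjacency keeps the merged vertex free of loops, and
  \<open>cyclic_on_transpose\<close> provides its rotation.\<close>

lemma rotation_map_identify:
  assumes ab: "a \<in> darts" "b \<in> darts" "org a \<noteq> org b"
    and nadj: "\<And>x. x \<in> darts \<Longrightarrow> org x = org a \<Longrightarrow> dst x \<noteq> org b"
  shows "rotation_map (identify M a b)"
proof -
  define r where "r x = (if x = org b then org a else x)" for x
  define H where "H = \<lparr>verts = r ` V, arcs = darts, tail = r \<circ> org, head = r \<circ> dst\<rparr>"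
  have skel: "skel (identify M a b) = H"
    by (simp add: identify_simps H_def r_def[abs_def])
  have nadj': "org x = org b \<Longrightarrow> dst x \<noteq> org a" if "x \<in> darts" for x
    using nadj[of "rv x"] that by auto
  interpret H: fin_digraph H by unfold_locales (auto simp: H_def)
  interpret H: bidirected_digraph H rv
    by (rule H.bidirected_digraphI) (auto simp: H_def arev_eq arev_neq)
  interpret H: loopfree_digraph H
  proof
    fix e assume "e \<in> arcs H"
    then have "e \<in> darts" by (simp add: H_def)
    then show "tail H e \<noteq> head H e"
      using no_loops[of e] nadj[of e] nadj'[of e] by (auto simp: H_def r_def)
  qed
  have out_a: "out_arcs H (org a) = out (org a) \<union> out (org b)"
    by (auto simp: H_def r_def)
  have out_other: "out_arcs H u = out u" if "u \<noteq> org a" "u \<noteq> org b" for u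
    using that by (auto simp: H_def r_def)
  have "cyclic_on (transpose a b \<circ> rt) (out_arcs H u)" if u: "u \<in> verts H" "out_arcs H u \<noteq> {}" for u
  proof (cases "u = org a")
    case True
    have "a \<in> out (org a)" "b \<in> out (org b)" using ab by auto
    then have "out (org a) \<noteq> {}" "out (org b) \<noteq> {}" by blast+
    then have "cyclic_on rt (out (org a))" "cyclic_on rt (out (org b))"
      using rot_cyclic ab by simp_all
    then show ?thesis unfolding True out_a
      by (rule cyclic_on_transpose) (use ab in auto)
  next
    case False
    then have "u \<noteq> org b" "u \<in> V" using u ab by (auto simp: H_def r_def split: if_splits)
    then have "cyclic_on rt (out u)" using u rot_cyclic out_other[OF False] by auto
    moreover have "rt x = (transpose a b \<circ> rt) x" if "x \<in> out u" for x
    proof -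
      have "org (rt x) = u" using that by simp
      then have "rt x \<noteq> a" "rt x \<noteq> b" using False \<open>u \<noteq> org b\<close> by auto
      then show ?thesis by (simp add: transpose_def)
    qed
    ultimately show ?thesis
      using cyclic_cong[of "out u" rt "transpose a b \<circ> rt"] out_other[OF False \<open>u \<noteq> org b\<close>] by simp
  qed
  moreover have "transpose a b \<circ> rt permutes darts"
    by (rule permutes_compose[OF rot_permutes permutes_swap_id]) (use ab in auto)
  moreover have "connected H"
  proof (rule connected_image[of _ r])
    show "sym_digraph H" by unfold_locales
    show "verts H = r ` V" by (simp add: H_def)
    show "r (org x) \<rightarrow>\<^sup>*\<^bsub>H\<^esub> r (dst x)" if "x \<in> darts" for x
      using that by (intro H.reachable_adjI) (auto simp: arcs_ends_conv H_def)
  qed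
  ultimately show ?thesis
    unfolding rotation_map_def rotation_map_axioms_def skel identify_simps(2,3)
    using H.fin_digraph_axioms H.bidirected_digraph_axioms H.loopfree_digraph_axioms
    by (auto simp: H_def)
qed

end

section \<open>Deletion of vertices\<close>

lemma cyclic_on_funpow_card:
  assumes "cyclic_on f S" "x \<in> S"
  shows "(f ^^ card S) x = x" "S = (\<lambda>k. (f ^^ k) x) ` {..<card S}"
    "inj_on (\<lambda>k. (f ^^ k) x) {..<card S}"
proof -
  have S: "S = orbit f x" and x: "x \<in> orbit f x"
    using assms by (auto simp: cyclic_on_alldef)
  let ?n = "funpow_dist1 f x x"
  have im: "S = (\<lambda>k. (f ^^ k) x) ` {..<?n}"
    using orbit_conv_funpow_dist1[OF x] S by (simp add: lessThan_atLeast0)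
  moreover have inj: "inj_on (\<lambda>k. (f ^^ k) x) {..<?n}"
    using inj_on_funpow_dist1[OF x] by (simp add: lessThan_atLeast0)
  ultimately have "card S = ?n" by (simp add: card_image)
  then show "(f ^^ card S) x = x" "S = (\<lambda>k. (f ^^ k) x) ` {..<card S}"
    "inj_on (\<lambda>k. (f ^^ k) x) {..<card S}"
    using im inj funpow_dist1_prop[OF x] by simp_all
qed

lemma maximal_planar_imp_triangulation:
  assumes "maximal_planar M"
  shows "triangulation M"
proof -
  interpret maximal_planar M by fact
  interpret rotation_map M
    by unfold_locales (use rot_permutes rot_cyclic connected_skel in auto)
  interpret triangular_map M
  proof
    fix x assume x: "x \<in> darts"
    have "fs permutes darts"
      unfolding face_succ_def by (rule permutes_compose[OF arev_permutes_arcs rot_permutes])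
    then have "permutation fs" using permutation_permutes finite_arcs by blast
    then have "cyclic_on fs (face M x)" "x \<in> face M x"
      unfolding face_def by (rule cyclic_on_orbit', rule permutation_self_in_orbit)
    moreover have "card (face M x) = 3" by (rule triangular) (simp add: faces_def x)
    ultimately have "(fs ^^ 3) x = x" using cyclic_on_funpow_card(1)[of fs "face M x" x] by simp
    then show "fs (fs (fs x)) = x" by (simp add: numeral_3_eq_3)
  qed
  show ?thesis
  proof
    have "even (card darts)" by (rule card_rev_closed(1)) auto
    then show "6 * card V = card darts + 12"
      using euler card_faces by (auto elim!: evenE)
  qed
qed

context triangulation
begin

text \<open>Every contraction starts from a maximal planar map, so the arc count must be turned back
  into the Euler characteristic.\<close>

lemma maximal_planar: "maximal_planar M"
proof
  obtain e where "card darts = 2 * e" using card_rev_closed(1)[of darts] by (auto elim: evenE)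
  then show "int (card V) - int (card darts div 2) + int (card (faces M)) = 2"
    using card_faces card_arcs by simp
  show "card f = 3" if "f \<in> faces M" for f
    using that card_face by (auto simp: faces_def face_eq)
qed (use rot_permutes rot_cyclic connected_skel in auto)

lemma no_digon: "\<not> digon M a"
  using face_eq[of a] card_face[of a] by (auto simp: digon_def)

text \<open>Three vertices leave 6 arcs. One triangle and its reversed arcs realize all six ordered
  pairs, so no two arcs are parallel.\<close>

lemma complete_digraph_3:
  assumes "card V = 3"
  shows "K\<^bsub>3\<^esub> (skel M)"
proof -
  have c6: "card darts = 6" using card_arcs assms by simp
  then have "darts \<noteq> {}" by auto
  then obtain x where x: "x \<in> darts" by blast
  define y z where "y = fs x" and "z = fs y"
  have yz: "y \<in> darts" "z \<in> darts" "org y = dst x" "org z = dst y" "dst z = org x"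
    using x fs3[OF x] org_fs[of x] org_fs[of y] org_fs[of z] by (auto simp: y_def z_def)
  have ne: "org x \<noteq> org y" "org y \<noteq> org z" "org z \<noteq> org x"
    using x yz no_loops by metis+
  have "{org x, org y, org z} \<subseteq> V" "card {org x, org y, org z} = 3" using x yz ne by auto
  then have V: "V = {org x, org y, org z}"
    using assms by (metis card_subset_eq finite_verts)
  let ?E = "{(org x, org y), (org y, org z), (org z, org x), (org y, org x), (org z, org y), (org x, org z)}"
  have "?E = arc_to_ends (skel M) ` {x, y, z, rv x, rv y, rv z}"
    using x yz by (auto simp: arc_to_ends_def)
  moreover have "{x, y, z, rv x, rv y, rv z} \<subseteq> darts" using x yz by simp
  ultimately have sub: "?E \<subseteq> arcs_ends (skel M)" unfolding arcs_ends_def by (metis image_mono)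
  have cE: "card ?E = 6" using ne by auto
  have le: "card (arcs_ends (skel M)) \<le> 6" unfolding arcs_ends_def c6[symmetric] by (rule card_image_le) simp
  have finE: "finite (arcs_ends (skel M))" by (simp add: arcs_ends_def)
  then have E: "arcs_ends (skel M) = ?E"
    using sub le cE by (metis card_seteq)
  have "inj_on (arc_to_ends (skel M)) darts"
    by (rule eq_card_imp_inj_on) (use E cE c6 in \<open>auto simp: arcs_ends_def\<close>)
  then have "nomulti_digraph (skel M)"
    by unfold_locales (auto dest: inj_onD)
  then interpret nomulti_digraph "skel M" .
  have "graph (skel M)" by unfold_locales
  moreover have "arcs_ends (skel M) = {(u, v). (u, v) \<in> V \<times> V \<and> u \<noteq> v}"
    unfolding E V using ne by auto
  ultimately show ?thesis using assms by (simp add: complete_digraph_def)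
qed

text \<open>At a vertex of degree 1 both arcs of its only edge would lie on one triangle, whose
  third side would be a loop.\<close>

lemma rt_neq:
  assumes "x \<in> darts"
  shows "rt x \<noteq> x"
proof
  assume "rt x = x"
  then have "fs (fs x) = rv x" using fs3[of "rv x"] assms by simp
  then have "dst (fs x) = dst x" using assms org_fs[of "fs x"] by simp
  then show False using no_loops[of "fs x"] assms by simp
qed

lemma two_le_card_out:
  assumes "v \<in> V" "out v \<noteq> {}"
  shows "2 \<le> card (out v)"
proof -
  obtain x where x: "x \<in> out v" using assms by blast
  then have "{x, rt x} \<subseteq> out v" "card {x, rt x} = 2" using rt_neq[of x] by auto
  then show ?thesis using card_mono[OF finite_out_arcs, of "{x, rt x}" v] by simp
qed

lemma wheel_center_iff:
  assumes "v \<in> V" "inj_on dst (out v)"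
  shows "wheel_center M i v \<longleftrightarrow> card (out v) = i"
proof -
  have "neighbors M v = dst ` out v"
    by (auto simp: neighbors_def adjacent_iff)
  then show ?thesis using assms by (auto simp: wheel_center_def out_degree_def card_image)
qed

section \<open>Removing a vertex; its rim as a face\<close>

lemma delete_vertex_skel:
  "verts (skel (delete_vertex M v)) = V - {v}"
  "arcs (skel (delete_vertex M v)) = {x \<in> darts. org x \<noteq> v \<and> dst x \<noteq> v}"
  "tail (skel (delete_vertex M v)) = org" "head (skel (delete_vertex M v)) = dst"
  by (auto simp: delete_vertex_def restrict_to_simps pre_digraph.del_vert_def)

text \<open>The side opposite to \<open>org d\<close> in the triangle between the spokes \<open>d\<close> and \<open>rt d\<close>.\<close>

definition opp :: "'e \<Rightarrow> 'e" where
  "opp d = fs (rt d)"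

lemma opp_ends:
  assumes "d \<in> darts"
  shows "opp d \<in> darts" "org (opp d) = dst (rt d)" "dst (opp d) = dst d" "fs (opp d) = rv d"
proof -
  show d: "opp d \<in> darts" "org (opp d) = dst (rt d)" using assms by (simp_all add: opp_def)
  show "fs (opp d) = rv d" using fs3[of "rv d"] assms by (simp add: opp_def)
  then show "dst (opp d) = dst d" using org_fs[OF d(1)] assms by simp
qed

lemma opp_inj: "opp d = opp d' \<longleftrightarrow> d = d'"
  by (simp add: opp_def fs_inj rt_inj)

lemma opp_in_delete_vertex:
  assumes "d \<in> out v"
  shows "opp d \<in> arcs (skel (delete_vertex M v))"
  using assms opp_ends[of d] no_loops[of d] no_loops[of "rt d"] by (auto simp: delete_vertex_skel)

lemma opp_in_rim:
  assumes "d \<in> out v"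
  shows "opp d \<in> rim M v"
proof -
  have d: "d \<in> darts" using assms by simp
  have "fs (fs (opp d)) = rt d" using opp_ends[OF d] by simp
  then have "rt d \<in> face M (opp d)" using face_eq[OF opp_ends(1)[OF d]] by simp
  then show ?thesis using opp_in_delete_vertex[OF assms] assms
    unfolding rim_def by (auto intro!: bexI[of _ "rt d"])
qed

text \<open>An edge with the rim on both sides forces degree 2. Around larger wheels the other side
  of a rim edge is thus a face that survives.\<close>

lemma rv_opp_eq_oppD:
  assumes "d \<in> out v" "d' \<in> out v" "inj_on dst (out v)" "rv (opp d) = opp d'"
  shows "rt (rt d) = d" "d' = rt d"
proof -
  have d: "d \<in> darts" "d' \<in> darts" "rt d \<in> out v" "rt d' \<in> out v" using assms by auto
  have "dst (rt d) = dst d'" "dst (rt d') = dst d"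
    using opp_ends[OF d(1)] opp_ends[OF d(2)] assms(4) head_arev[of "opp d"] tail_arev[of "opp d"]
    by auto
  then have "rt d = d'" "rt d' = d" using assms d by (auto dest: inj_onD)
  then show "rt (rt d) = d" "d' = rt d" by auto
qed

text \<open>The triangles at \<open>v\<close> merge into one face, whose walk runs through the arcs
  \<open>opp d\<close> against the rotation at \<open>v\<close>; the other faces persist.\<close>

lemma rotation_map_delete_vertex:
  assumes v: "v \<in> V" and ne: "out v \<noteq> {}"
  shows "rotation_map (delete_vertex M v)"
    and "card (arcs (skel (delete_vertex M v))) + 2 * card (out v) = card darts"
    and "card (verts (skel (delete_vertex M v))) + 1 = card V"
    and "x \<in> arcs (skel (delete_vertex M v)) \<Longrightarrow> rev_arc (delete_vertex M v) x = rv x"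
    and "d \<in> out v \<Longrightarrow> face_succ (delete_vertex M v) (opp (rt d)) = opp d"
    and "x \<in> arcs (skel (delete_vertex M v)) \<Longrightarrow> x \<notin> opp ` out v \<Longrightarrow>
      face_succ (delete_vertex M v) x = fs x"
proof -
  define H where "H = pre_digraph.del_vert (skel M) v"
  have D: "delete_vertex M v = restrict_to M H" by (simp add: delete_vertex_def H_def)
  have H: "verts H = V - {v}" "arcs H = {x \<in> darts. org x \<noteq> v \<and> dst x \<noteq> v}"
    "tail H = org" "head H = dst"
    by (auto simp: H_def pre_digraph.del_vert_def)
  have wf: "rv x \<in> arcs H" if "x \<in> arcs H" for x
    using that unfolding H by auto
  \<comment> \<open>Two consecutive arcs at another vertex cannot both end in \<open>v\<close>, as
    the third side of their triangle would be a loop at \<open>v\<close>.\<close>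
  have rt_fs: "rt (fs x) \<in> arcs H" if x: "x \<in> darts" "dst x \<noteq> v" "dst (fs x) = v" for x
  proof -
    let ?d = "rv (fs x)"
    have d: "?d \<in> darts" "org ?d = v" using x by simp_all
    have eq: "rt (fs x) = fs ?d" by simp
    have "dst (fs ?d) \<noteq> v"
    proof
      assume a: "dst (fs ?d) = v"
      have "org (fs (fs ?d)) = v" using a d by simp
      moreover have "dst (fs (fs ?d)) = v" using fs3[OF d(1)] d org_fs[of "fs (fs ?d)"] by simp
      ultimately show False using no_loops[of "fs (fs ?d)"] d by simp
    qed
    then show ?thesis using x d unfolding H eq by auto
  qed
  have gap: "rt x \<in> arcs H \<or> rt (rt x) \<in> arcs H" if x: "x \<in> arcs H" for x
  proof (cases "dst (rt x) = v")
    case True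
    then show ?thesis using rt_fs[of "rv x"] x H by simp
  next
    case False
    then show ?thesis using x H by simp
  qed
  have "fin_digraph H"
    by unfold_locales (use H in auto)
  then interpret H: fin_digraph H .
  interpret H: sym_digraph H
  proof
    show "symmetric H"
      unfolding symmetric_conv
    proof
      fix e assume "e \<in> arcs H"
      then show "\<exists>e'\<in>arcs H. tail H e = head H e' \<and> head H e = tail H e'"
        using wf[of e] by (intro bexI[of _ "rv e"]) (auto simp: H)
    qed
  qed
  obtain d0 where d0: "d0 \<in> out v" using ne by blast
  \<comment> \<open>The neighbours of \<open>v\<close> remain connected along the rim, so any one of
    them can stand in for \<open>v\<close>.\<close>
  define r where "r u = (if u = v then dst d0 else u)" for u
  have spoke: "dst d0 \<rightarrow>\<^sup>*\<^bsub>H\<^esub> dst d" if "d \<in> out v" for d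
  proof -
    have "out (org d0) \<subseteq> {d. dst d0 \<rightarrow>\<^sup>*\<^bsub>H\<^esub> dst d}"
    proof (rule out_subset)
      show "d0 \<in> darts" using d0 by simp
      have "dst d0 \<in> verts H" using d0 no_loops[of d0] H by auto
      then show "d0 \<in> {d. dst d0 \<rightarrow>\<^sup>*\<^bsub>H\<^esub> dst d}" by simp
      fix d assume d: "d \<in> {d. dst d0 \<rightarrow>\<^sup>*\<^bsub>H\<^esub> dst d}" "d \<in> out (org d0)"
      then have "d \<in> out v" using d0 by simp
      then have o: "opp d \<in> arcs H" "d \<in> darts"
        using opp_in_delete_vertex[of d v] by (auto simp: D restrict_to_simps)
      have "dst d \<rightarrow>\<^bsub>H\<^esub> dst (rt d)"
        unfolding arcs_ends_conv
        by (rule image_eqI[of _ _ "rv (opp d)"])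
          (use wf[OF o(1)] opp_ends[OF o(2)] H in simp_all)
      then show "rt d \<in> {d. dst d0 \<rightarrow>\<^sup>*\<^bsub>H\<^esub> dst d}"
        using d(1) H.reachable_adj_trans by blast
    qed
    then show ?thesis using that d0 by auto
  qed
  have conn: "r (org x) \<rightarrow>\<^sup>*\<^bsub>H\<^esub> r (dst x)" if x: "x \<in> darts" for x
  proof -
    consider "x \<in> arcs H" | "org x = v" "dst x \<noteq> v" | "dst x = v" "org x \<noteq> v"
      using x no_loops[OF x] by (cases "org x = v"; cases "dst x = v") (simp_all add: H(2))
    then show ?thesis
    proof cases
      case 1
      then have "org x \<rightarrow>\<^bsub>H\<^esub> dst x" using H by (auto simp: arcs_ends_conv)
      then show ?thesis using 1 H by (auto simp: r_def)
    next
      case 2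
      then show ?thesis using spoke[of x] x by (simp add: r_def)
    next
      case 3
      then have "dst d0 \<rightarrow>\<^sup>*\<^bsub>H\<^esub> org x" using spoke[of "rv x"] x by simp
      then show ?thesis using 3 H.symmetric_reachable' by (simp add: r_def)
    qed
  qed
  have "dst d0 \<in> V" "dst d0 \<noteq> v" using d0 no_loops[of d0] by auto
  then have img: "verts H = r ` V" using H by (auto simp: r_def image_iff)
  have pre: "arcs H \<subseteq> darts" "finite (verts H)" "\<And>x. x \<in> arcs H \<Longrightarrow> org x \<in> verts H"
    using H by auto
  have R: "rotation_map (restrict_to M H)"
    "\<And>x. x \<in> arcs H \<Longrightarrow>
      face_succ (restrict_to M H) x = (if fs x \<in> arcs H then fs x else rt (fs x))"
    by (rule rotation_map_restrict_to[OF pre(1) H(3,4) pre(2) wf pre(3) gap img conn]; assumption)+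
  show "rotation_map (delete_vertex M v)" unfolding D by (rule R(1))
  have split: "darts = arcs H \<union> (out v \<union> rv ` out v)"
  proof (intro equalityI subsetI)
    fix x assume x: "x \<in> darts"
    then have "x \<in> arcs H \<or> x \<in> out v \<or> rv x \<in> out v" by (auto simp: H(2))
    moreover have "x = rv (rv x)" by simp
    ultimately show "x \<in> arcs H \<union> (out v \<union> rv ` out v)" by blast
  qed (auto simp: H(2))
  have "card (rv ` out v) = card (out v)" by (rule card_image) (rule inj_on_arev)
  moreover have "card (out v \<union> rv ` out v) = card (out v) + card (rv ` out v)"
  proof (rule card_Un_disjoint)
    have "x \<notin> out v" if "x \<in> rv ` out v" for x using that no_loops by force
    then show "out v \<inter> rv ` out v = {}" by blast
  qed (use finite_out_arcs[of v] in auto)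
  moreover have "card darts = card (arcs H) + card (out v \<union> rv ` out v)"
  proof -
    have "arcs H \<inter> (out v \<union> rv ` out v) = {}" by (auto simp: H(2))
    moreover have "finite (arcs H)" "finite (out v \<union> rv ` out v)" using finite_out_arcs[of v] by auto
    ultimately have "card (arcs H \<union> (out v \<union> rv ` out v)) = card (arcs H) + card (out v \<union> rv ` out v)"
      by (intro card_Un_disjoint)
    then show ?thesis by (simp only: split[symmetric])
  qed
  ultimately show "card (arcs (skel (delete_vertex M v))) + 2 * card (out v) = card darts"
    by (simp add: D restrict_to_simps)
  show "card (verts (skel (delete_vertex M v))) + 1 = card V"
    using v card_Suc_Diff1[of V v] by (simp add: D restrict_to_simps H)
  show "rev_arc (delete_vertex M v) x = rv x" if "x \<in> arcs (skel (delete_vertex M v))"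
    using that by (simp add: D restrict_to_simps perm_restrict_simps)
  show "face_succ (delete_vertex M v) (opp (rt d)) = opp d" if d: "d \<in> out v"
  proof -
    have "rt d \<in> out v" using d by auto
    then have "opp (rt d) \<in> arcs H"
      using opp_in_delete_vertex[of "rt d" v] by (simp add: D restrict_to_simps)
    moreover have "fs (opp (rt d)) = rv (rt d)" using d by (simp add: opp_ends)
    moreover have "rv (rt d) \<notin> arcs H" using d H by simp
    ultimately show ?thesis unfolding D by (simp add: R(2) rt_rv opp_def)
  qed
  show "face_succ (delete_vertex M v) x = fs x"
    if x: "x \<in> arcs (skel (delete_vertex M v))" "x \<notin> opp ` out v"
  proof -
    have xH: "x \<in> arcs H" using x by (simp add: D restrict_to_simps)
    then have xd: "x \<in> darts" "dst x \<noteq> v" by (auto simp: H)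
    have "dst (fs x) \<noteq> v"
    proof
      assume "dst (fs x) = v"
      then have "rv (fs x) \<in> out v" using xd by simp
      moreover have "opp (rv (fs x)) = x" using fs3[OF xd(1)] by (simp add: opp_def rt_rv)
      ultimately show False using x(2) by (metis imageI)
    qed
    then have "fs x \<in> arcs H" using xd by (simp add: H)
    then show ?thesis unfolding D by (simp add: R(2)[OF xH])
  qed
qed

end

section \<open>Contraction of wheels\<close>

lemma triangulationI:
  assumes "rotation_map N"
    and "\<And>x. x \<in> arcs (skel N) \<Longrightarrow> face_succ N (face_succ N (face_succ N x)) = x"
    and "6 * card (verts (skel N)) = card (arcs (skel N)) + 12"
  shows "triangulation N"
  using assms
  by (simp add: triangulation_def triangular_map_def triangular_map_axioms_def triangulation_axioms_def)

context triangulation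
begin

text \<open>The old predecessor of \<open>opp d\<close> is the spoke \<open>rt d\<close>. Hence the
  walk from a surviving arc off the rim never enters the rim, and its triangle stays intact.\<close>

lemma off_rim:
  assumes v: "v \<in> V" "out v \<noteq> {}" and x: "x \<in> arcs (skel (delete_vertex M v))" "x \<notin> opp ` out v"
  defines "g \<equiv> face_succ (delete_vertex M v)"
  shows "g x = fs x" "g x \<in> arcs (skel (delete_vertex M v)) - opp ` out v" "g (g (g x)) = x"
proof -
  interpret N: rotation_map "delete_vertex M v" by (rule rotation_map_delete_vertex(1)[OF v])
  have g: "g y = fs y" if "y \<in> arcs (skel (delete_vertex M v))" "y \<notin> opp ` out v" for y
    unfolding g_def by (rule rotation_map_delete_vertex(6)[OF v that])
  have step: "fs y \<in> arcs (skel (delete_vertex M v)) \<and> fs y \<notin> opp ` out v"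
    if y: "y \<in> arcs (skel (delete_vertex M v))" "y \<notin> opp ` out v" for y
  proof
    show "fs y \<in> arcs (skel (delete_vertex M v))"
    proof -
      have "g y \<in> arcs (skel (delete_vertex M v))" unfolding g_def using y by simp
      then show ?thesis by (simp only: g[OF y])
    qed
    show "fs y \<notin> opp ` out v"
    proof
      assume "fs y \<in> opp ` out v"
      then obtain d where d: "fs y = opp d" "d \<in> out v" by (rule imageE)
      then have "org y = v" by (simp add: opp_def fs_inj)
      then show False using y by (simp add: delete_vertex_skel)
    qed
  qed
  note s1 = step[OF x]
  note s2 = step[OF conjunct1[OF s1] conjunct2[OF s1]]
  have "x \<in> darts" using x by (simp add: delete_vertex_skel)
  then have f: "fs (fs (fs x)) = x" by (rule fs3)
  have g1: "g x = fs x" and g2: "g (fs x) = fs (fs x)" and g3: "g (fs (fs x)) = fs (fs (fs x))"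
    using g[OF x] g[OF conjunct1[OF s1] conjunct2[OF s1]] g[OF conjunct1[OF s2] conjunct2[OF s2]] .
  show "g x = fs x" by (rule g1)
  show "g x \<in> arcs (skel (delete_vertex M v)) - opp ` out v" unfolding g1 using s1 by blast
  show "g (g (g x)) = x" by (simp only: g1 g2 g3 f)
qed

text \<open>Four arcs go with \<open>v\<close> and two with the merged edge. The point is that the
  two rim arcs belong to different edges.\<close>

lemma contract_wheel_2:
  assumes V: "4 \<le> card V" and v: "v \<in> V" "out v = {d, rt d}" "d \<noteq> rt d" "rt (rt d) = d"
    and inj: "inj_on dst (out v)"
  shows "\<exists>N. contracts M N \<and> triangulation N \<and> card (verts (skel N)) + 1 = card V"
proof -
  define N where "N = delete_vertex M v"
  define Q where "Q = delete_edge N (opp d)"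
  have ne: "out v \<noteq> {}" using v by simp
  have card2: "card (out v) = 2" using v by simp
  have in_v: "d \<in> out v" "rt d \<in> out v" using v by auto
  then have dd: "d \<in> darts" by simp
  note dv = rotation_map_delete_vertex[OF v(1) ne, folded N_def]
  interpret N: rotation_map N by (rule dv)
  have g: "N.fs (opp (rt d)) = opp d" "N.fs (opp d) = opp (rt d)"
    using dv(5)[of d] dv(5)[of "rt d"] in_v v(4) by simp_all
  have c: "opp d \<in> arcs (skel N)" "opp (rt d) \<in> arcs (skel N)"
    using opp_in_delete_vertex in_v unfolding N_def by blast+
  have rvN: "N.rv (opp d) = rv (opp d)" using dv(4) c by simp
  have "opp (rt d) \<noteq> rv (opp d)"
  proof
    assume eq: "opp (rt d) = rv (opp d)"
    \<comment> \<open>Otherwise these six arcs are closed under \<open>rv\<close> and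
      \<open>rt\<close> and the map is a bare triangle, whereas four vertices require 12
      arcs.\<close>
    let ?S = "{d, rt d, rv d, rv (rt d), opp d, opp (rt d)}"
    have r: "rv (opp (rt d)) = opp d" by (simp add: eq)
    have "rt (rv (opp (rt d))) = rv (rt d)" using dd by (simp only: rt_rv opp_ends(4) rt_in_iff)
    moreover have "rt (rv (opp d)) = rv d" using dd by (simp only: rt_rv opp_ends(4))
    moreover have "rt (rv d) = opp (rt d)" "rt (rv (rt d)) = opp d"
      by (simp_all only: rt_rv opp_def v(4))
    ultimately have "rv y \<in> ?S \<and> rt y \<in> ?S" if "y \<in> ?S" for y
      using that v(4) r eq[symmetric] by (elim insertE) simp_all
    then have "darts \<subseteq> ?S"
      by (intro darts_subset[OF dd]) simp_all
    then have "card darts \<le> card ?S" by (rule card_mono[rotated]) simp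
    also have "\<dots> \<le> 6" 
      using card_length[of "[d, rt d, rv d, rv (rt d), opp d, opp (rt d)]"] by simp
    finally show False using card_arcs V by simp
  qed
  then have ndig: "opp (rt d) \<noteq> N.rv (opp d)" by (simp add: rvN)
  note dig = c(1) g(2,1) ndig
  have del: "rotation_map Q" "card (arcs (skel Q)) + 2 = card (arcs (skel N))"
    unfolding Q_def using N.rotation_map_delete_edge(1,2)[OF dig] by blast+
  have rim: "opp ` out v = {opp d, opp (rt d)}" using v by auto
  have tri: "N.fs (N.fs (N.fs x)) = x" if "x \<in> arcs (skel N)" "x \<noteq> opp d" "x \<noteq> opp (rt d)" for x
    using off_rim(3)[OF v(1) ne, of x] that rim by (simp add: N_def)
  have ne_rv: "N.rv (opp d) \<noteq> opp d" using N.arev_neq c by blast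
  have tri_rv: "N.fs (N.fs (N.fs (N.rv (opp d)))) = N.rv (opp d)"
    by (rule tri) (use ndig ne_rv c in auto)
  have Qsk: "verts (skel Q) = verts (skel N)" "arcs (skel Q) = arcs (skel N) - {opp d, N.rv (opp d)}"
    unfolding Q_def by (rule N.delete_edge_skel)+
  have "triangulation Q"
  proof (rule triangulationI)
    show "rotation_map Q" by (rule del)
    show "6 * card (verts (skel Q)) = card (arcs (skel Q)) + 12"
      using del(2) dv(2,3) card2 card_arcs unfolding Qsk(1) by linarith
    fix x assume "x \<in> arcs (skel Q)"
    then have x: "x \<in> arcs (skel N) - {opp d, N.rv (opp d)}" unfolding Qsk .
    then have "x = opp (rt d) \<or> N.fs (N.fs (N.fs x)) = x" using tri by blast
    then show "face_succ Q (face_succ Q (face_succ Q x)) = x"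
      unfolding Q_def by (rule N.delete_edge_triangular[OF dig tri_rv x])
  qed
  moreover have "contract_wheel 2 M Q"
    unfolding Q_def N_def
  proof (rule contract_wheel.wheel2)
    show "maximal_planar M" by (rule maximal_planar)
    show "wheel_center M 2 v" using wheel_center_iff[OF v(1) inj] card2 by simp
    show "opp d \<in> rim M v" by (rule opp_in_rim[OF in_v(1)])
    show "digon (delete_vertex M v) (opp d)"
      using N.digonI[OF dig] by (simp add: N_def)
  qed simp
  ultimately show ?thesis
    using dv(3) unfolding contracts_def by (intro exI[of _ Q]) (auto simp: Q_def N.delete_edge_skel)
qed

text \<open>The rim itself becomes a triangular face; six arcs go with one vertex.\<close>

lemma contract_wheel_3:
  assumes v: "v \<in> V" "out v = {d, rt d, rt (rt d)}" "card (out v) = 3" "rt (rt (rt d)) = d"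
    and inj: "inj_on dst (out v)"
  shows "\<exists>N. contracts M N \<and> triangulation N \<and> card (verts (skel N)) + 1 = card V"
proof -
  define N where "N = delete_vertex M v"
  have ne: "out v \<noteq> {}" using v by simp
  note dv = rotation_map_delete_vertex[OF v(1) ne, folded N_def]
  have g: "face_succ N (opp (rt d)) = opp d" "face_succ N (opp (rt (rt d))) = opp (rt d)"
    "face_succ N (opp d) = opp (rt (rt d))"
    using dv(5)[of d] dv(5)[of "rt d"] dv(5)[of "rt (rt d)"] v by simp_all
  have "triangulation N"
  proof (rule triangulationI)
    show "rotation_map N" by (rule dv)
    fix x assume x: "x \<in> arcs (skel N)"
    show "face_succ N (face_succ N (face_succ N x)) = x"
    proof (cases "x \<in> opp ` out v")
      case True
      then show ?thesis using g v(2) by auto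
    next
      case False
      then show ?thesis using off_rim(3)[OF v(1) ne] x by (simp add: N_def)
    qed
  qed (use dv(2,3) v(3) card_arcs in auto)
  moreover have "contract_wheel 3 M N"
    unfolding N_def
    by (rule contract_wheel.wheel3) (use maximal_planar wheel_center_iff[OF v(1) inj] v(3) in auto)
  ultimately show ?thesis using dv(3) by (auto simp: contracts_def)
qed

text \<open>Let \<open>d2\<close>, \<open>d3\<close>, \<open>d4\<close> be the spokes after
  \<open>d\<close>, and \<open>e\<close> the one before it. The rim walk passes
  \<open>opp d3\<close>, \<open>opp d2\<close>, \<open>opp d\<close>, \<open>opp e\<close>, and the
  far ends of \<open>d3\<close> and \<open>d\<close> are the tails of \<open>opp d2\<close> and
  \<open>opp e\<close>. Splicing there cuts off the digon \<open>opp d\<close>,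
  \<open>opp d2\<close> and leaves the digon \<open>opp d3\<close>, \<open>opp e\<close> for degree
  4, or the triangle \<open>opp d3\<close>, \<open>opp e\<close>, \<open>opp d4\<close> for degree
  5. In all 8 + 2 + 2 or 10 + 2 arcs go with two vertices.\<close>

lemma contract_wheel_4_5:
  assumes v: "v \<in> V" "d \<in> out v" and inj: "inj_on dst (out v)"
    and distinct: "distinct [d, rt d, rt (rt d), e]"
    and e: "e \<in> out v" "rt e = d"
    and cases: "card (out v) = 4 \<and> e = rt (rt (rt d)) \<and> out v = {d, rt d, rt (rt d), e} \<or>
      card (out v) = 5 \<and> e = rt (rt (rt (rt d))) \<and>
        out v = {d, rt d, rt (rt d), rt (rt (rt d)), e}"
    and nadj: "\<not> adjacent M (dst d) (dst (rt (rt d)))"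
  shows "\<exists>N. contracts M N \<and> triangulation N \<and> card (verts (skel N)) + 2 = card V"
proof -
  define N where "N = delete_vertex M v"
  define d2 d3 d4 where "d2 = rt d" and "d3 = rt d2" and "d4 = rt d3"
  define P where "P = identify N (opp d2) (opp e)"
  define Q where "Q = delete_edge P (opp d)"
  have ne: "out v \<noteq> {}" using v by blast
  have in_v: "d \<in> out v" "d2 \<in> out v" "d3 \<in> out v" "d4 \<in> out v" "e \<in> out v"
    using v e by (auto simp: d2_def d3_def d4_def)
  have dist: "distinct [d, d2, d3, e]" using distinct by (simp add: d2_def d3_def)
  have cases': "card (out v) = 4 \<and> d4 = e \<and> out v = {d, d2, d3, e} \<or>
      card (out v) = 5 \<and> rt d4 = e \<and> d4 \<notin> {d, d2, d3, e} \<and> out v = {d, d2, d3, d4, e}"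
  proof -
    have "d4 \<notin> {d, d2, d3, e}" if "card (out v) = 5" "out v = {d, d2, d3, d4, e}"
    proof
      assume "d4 \<in> {d, d2, d3, e}"
      then have "out v = {d, d2, d3, e}" using that by blast
      then show False using that(1) dist by simp
    qed
    then show ?thesis using cases unfolding d2_def d3_def d4_def by blast
  qed
  note dv = rotation_map_delete_vertex[OF v(1) ne, folded N_def]
  interpret N: rotation_map N by (rule dv)
  have c: "opp x \<in> arcs (skel N)" if "x \<in> out v" for x
    using opp_in_delete_vertex[OF that] by (simp add: N_def)
  have Nsk: "tail (skel N) = org" "head (skel N) = dst" "arcs (skel N) \<subseteq> darts"
    by (auto simp: N_def delete_vertex_skel)
  have rvN: "N.rv x = rv x" if "x \<in> arcs (skel N)" for x using dv(4) that by simp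
  have g: "N.fs (opp d2) = opp d" "N.fs (opp d) = opp e" "N.fs (opp d3) = opp d2"
    "N.fs (opp d4) = opp d3" "N.fs (opp (rt d4)) = opp d4"
    using dv(5)[of d] dv(5)[of e] dv(5)[of d2] dv(5)[of d3] dv(5)[of d4] in_v e
    by (simp_all add: d2_def d3_def d4_def)
  have ends: "org (opp d2) = dst d3" "org (opp e) = dst d"
    using opp_ends(2) in_v e by (auto simp: d3_def)
  have "dst d3 \<noteq> dst d" using inj in_v dist unfolding inj_on_def by auto
  have "rotation_map P"
    unfolding P_def
  proof (rule N.rotation_map_identify)
    show "opp d2 \<in> arcs (skel N)" "opp e \<in> arcs (skel N)" using c in_v by auto
    show "tail (skel N) (opp d2) \<noteq> tail (skel N) (opp e)"
      using ends \<open>dst d3 \<noteq> dst d\<close> by (simp add: Nsk)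
    fix x assume x: "x \<in> arcs (skel N)" "tail (skel N) x = tail (skel N) (opp d2)"
    then have "rv x \<in> darts" "dst (rv x) = dst d3" using Nsk ends by auto
    then show "head (skel N) x \<noteq> tail (skel N) (opp e)"
      using nadj x Nsk ends unfolding adjacent_iff d3_def d2_def by (metis subsetD tail_arev)
  qed
  then interpret P: rotation_map P .
  have Psk: "arcs (skel P) = arcs (skel N)" "P.rv = N.rv"
    by (simp_all add: P_def N.identify_simps)
  have cP: "opp x \<in> arcs (skel P)" if "x \<in> out v" for x using c[OF that] by (simp add: Psk)
  have fP: "P.fs x = transpose (opp d2) (opp e) (N.fs x)" for x
    unfolding P_def by (rule N.face_succ_identify)
  have h: "P.fs (opp d) = opp d2" "P.fs (opp d2) = opp d" "P.fs (opp d3) = opp e"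
    using dist by (auto simp: fP g opp_inj)
  have tri_off: "P.fs (P.fs (P.fs x)) = x" if "x \<in> arcs (skel P)" "x \<notin> opp ` out v" for x
  proof -
    have P: "P.fs y = N.fs y \<and> N.fs y \<in> arcs (skel N) - opp ` out v"
      if "y \<in> arcs (skel N) - opp ` out v" for y
    proof -
      have *: "N.fs y \<in> arcs (skel N) - opp ` out v"
        using off_rim(2)[OF v(1) ne, of y] that by (simp add: N_def)
      then have "N.fs y \<noteq> opp d2" "N.fs y \<noteq> opp e" using in_v by auto
      then show ?thesis using * by (simp add: fP)
    qed
    have "N.fs (N.fs (N.fs x)) = x"
      using off_rim(3)[OF v(1) ne, of x] that by (simp add: N_def Psk)
    then show ?thesis using P[of x] P[of "N.fs x"] P[of "N.fs (N.fs x)"] that by (simp add: Psk)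
  qed
  \<comment> \<open>From degree 4 on, the other side of a rim edge is an unchanged triangle, as
    \<open>delete_edge_triangular\<close> requires.\<close>
  have rv_off: "P.rv (opp x) \<notin> opp ` out v" "P.rv (opp x) \<in> arcs (skel P)" if x: "x \<in> out v" for x
  proof
    assume "P.rv (opp x) \<in> opp ` out v"
    then obtain y where y: "y \<in> out v" "rv (opp x) = opp y"
      using rvN[OF c[OF x]] by (auto simp: Psk)
    have "rt (rt x) = x" using rv_opp_eq_oppD(1)[OF x y(1) inj y(2)] .
    moreover have "rt (rt d) \<noteq> d" "rt (rt d2) \<noteq> d2" "rt (rt d3) \<noteq> d3" "rt (rt d4) \<noteq> d4" "rt (rt e) \<noteq> e"
      using dist cases' e by (auto simp: d2_def d3_def d4_def rt_inj)
    moreover have "x \<in> {d, d2, d3, d4, e}" using x cases' by blast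
    ultimately show False by auto
  qed (use x cP in simp)
  have opp_neq: "opp x \<noteq> P.rv (opp y)" if "x \<in> out v" "y \<in> out v" for x y
    using imageI[OF that(1), of opp] rv_off(1)[OF that(2)] by metis
  have dig1: "opp d \<in> arcs (skel P)" "P.fs (opp d) = opp d2" "P.fs (opp d2) = opp d"
    "opp d2 \<noteq> P.rv (opp d)"
    by (fact cP[OF in_v(1)] h(1,2) opp_neq[OF in_v(2,1)])+
  have tri1: "P.fs (P.fs (P.fs (P.rv (opp d)))) = P.rv (opp d)"
    by (rule tri_off[OF rv_off(2)[OF in_v(1)] rv_off(1)[OF in_v(1)]])
  have mP: "merge_digon P Q"
    unfolding merge_digon_def Q_def using P.digonI[OF dig1] by blast
  have Q: "rotation_map Q" "card (arcs (skel Q)) + 2 = card (arcs (skel P))"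
    unfolding Q_def using P.rotation_map_delete_edge(1,2)[OF dig1] by blast+
  have fQ: "face_succ Q x =
      (if P.fs x = opp d then P.fs (P.rv (opp d)) else if P.fs x = P.rv (opp d) then opp d2 else P.fs x)"
    "rev_arc Q x = P.rv x" if "x \<in> arcs (skel P) - {opp d, P.rv (opp d)}" for x
    unfolding Q_def using P.rotation_map_delete_edge(3,4)[OF dig1 that] by blast+
  have Qsk: "verts (skel Q) = verts (skel P)" "arcs (skel Q) = arcs (skel P) - {opp d, P.rv (opp d)}"
    unfolding Q_def by (rule P.delete_edge_skel)+
  have triQ: "face_succ Q (face_succ Q (face_succ Q x)) = x"
    if "x \<in> arcs (skel P) - {opp d, P.rv (opp d)}" "x = opp d2 \<or> P.fs (P.fs (P.fs x)) = x" for x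
    unfolding Q_def by (rule P.delete_edge_triangular[OF dig1 tri1 that])
  interpret Q: rotation_map Q by (rule Q)
  have vP: "card (verts (skel P)) + 1 = card (verts (skel N))"
    unfolding P_def
    by (rule N.card_verts_identify) (use c in_v ends \<open>dst d3 \<noteq> dst d\<close> in \<open>auto simp: Nsk\<close>)
  \<comment> \<open>\<open>merge_digons\<close> demands that no digon be left, which holds in any
    triangulation.\<close>
  have contr: "contracts M R" if "merge_digon\<^sup>*\<^sup>* P R" "triangulation R" for R
  proof -
    have "merge_digons P R"
      using that triangulation.no_digon[OF that(2)] by (simp add: merge_digons_def)
    then have "merge_digons (identify (delete_vertex M v) (opp d2) (opp e)) R"
      by (simp add: P_def N_def)
    moreover have "opp e \<in> face (delete_vertex M v) (opp d2)"
      unfolding face_def N_def[symmetric] using g(1,2) orbit.intros by metis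
    moreover have "card (out v) \<in> {4, 5}" using cases by auto
    moreover have "wheel_center M (card (out v)) v" using wheel_center_iff[OF v(1) inj] by simp
    moreover have "\<not> adjacent M (org (opp d2)) (org (opp e))"
    proof
      assume "adjacent M (org (opp d2)) (org (opp e))"
      then obtain x where "x \<in> darts" "org x = dst d3" "dst x = dst d" by (auto simp: adjacent_iff ends)
      then show False using nadj unfolding adjacent_iff d3_def d2_def by (metis head_arev rv_in_iff tail_arev)
    qed
    moreover have "org (opp d2) \<noteq> org (opp e)" using ends \<open>dst d3 \<noteq> dst d\<close> by simp
    ultimately have "contract_wheel (card (out v)) M R"
      by (intro contract_wheel.wheel45[OF maximal_planar _ _ refl]) (auto intro: opp_in_rim in_v)
    then show ?thesis using \<open>card (out v) \<in> {4, 5}\<close> by (auto simp: contracts_def)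
  qed
  from cases' show ?thesis
  proof
    assume four: "card (out v) = 4 \<and> d4 = e \<and> out v = {d, d2, d3, e}"
    then have rim: "opp ` out v = {opp d, opp d2, opp d3, opp e}" by auto
    have h4: "P.fs (opp e) = opp d3" using g(4) four dist by (auto simp: fP opp_inj)
    define R where "R = delete_edge Q (opp d3)"
    \<comment> \<open>The first merge must leave both arcs of the second digon in place.\<close>
    have neq: "opp d3 \<noteq> opp d" "opp e \<noteq> opp d" "opp d3 \<noteq> P.rv (opp d)" "opp e \<noteq> P.rv (opp d)"
      using dist opp_neq[OF in_v(3,1)] opp_neq[OF in_v(5,1)] by (auto simp: opp_inj)
    have inQ: "opp d3 \<in> arcs (skel P) - {opp d, P.rv (opp d)}" "opp e \<in> arcs (skel P) - {opp d, P.rv (opp d)}"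
      using neq cP[OF in_v(3)] cP[OF in_v(5)] by simp_all
    have dig2: "opp d3 \<in> arcs (skel Q)" "Q.fs (opp d3) = opp e" "Q.fs (opp e) = opp d3"
      "opp e \<noteq> Q.rv (opp d3)"
      using inQ fQ[OF inQ(1)] fQ[OF inQ(2)] h h4 neq opp_neq[OF in_v(5,3)] by (simp_all add: Qsk)
    have "Q.rv (opp d3) \<in> arcs (skel Q)" using dig2(1) by simp
    then have "P.rv (opp d3) \<in> arcs (skel P) - {opp d, P.rv (opp d)}"
      unfolding fQ(2)[OF inQ(1)] Qsk(2) .
    then have tri2: "Q.fs (Q.fs (Q.fs (Q.rv (opp d3)))) = Q.rv (opp d3)"
      unfolding fQ(2)[OF inQ(1)]
      by (rule triQ[OF _ disjI2]) (rule tri_off[OF rv_off(2)[OF in_v(3)] rv_off(1)[OF in_v(3)]])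
    have "triangulation R"
    proof (rule triangulationI)
      show "rotation_map R" unfolding R_def by (rule Q.rotation_map_delete_edge(1)[OF dig2])
      have "card (arcs (skel R)) + 2 = card (arcs (skel Q))"
        unfolding R_def by (rule Q.rotation_map_delete_edge(2)[OF dig2])
      then show "6 * card (verts (skel R)) = card (arcs (skel R)) + 12"
        using Q(2) dv(2,3) vP conjunct1[OF four] card_arcs
        unfolding R_def Q.delete_edge_skel(1) Qsk(1) Psk(1) by linarith
      fix x assume "x \<in> arcs (skel R)"
      then have x: "x \<in> arcs (skel Q) - {opp d3, Q.rv (opp d3)}"
        unfolding R_def Q.delete_edge_skel .
      then have "x = opp e \<or> x = opp d2 \<or> x \<notin> opp ` out v" using rim Qsk by blast
      then have "x = opp e \<or> Q.fs (Q.fs (Q.fs x)) = x"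
        using triQ[of x] tri_off[of x] x Qsk(2) by blast
      then show "face_succ R (face_succ R (face_succ R x)) = x"
        unfolding R_def by (rule Q.delete_edge_triangular[OF dig2 tri2 x])
    qed
    moreover have "merge_digon Q R"
      unfolding merge_digon_def R_def using Q.digonI[OF dig2] by blast
    then have "merge_digon\<^sup>*\<^sup>* P R" using mP by auto
    moreover have "card (verts (skel R)) + 2 = card V"
      using vP dv(3) by (simp add: R_def Q.delete_edge_skel Qsk)
    ultimately show ?thesis using contr by blast
  next
    assume five: "card (out v) = 5 \<and> rt d4 = e \<and> d4 \<notin> {d, d2, d3, e} \<and> out v = {d, d2, d3, d4, e}"
    then have rim: "opp ` out v = {opp d, opp d2, opp d3, opp d4, opp e}" by auto
    have h4: "P.fs (opp e) = opp d4" "P.fs (opp d4) = opp d3"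
      using g(4,5) five dist by (auto simp: fP opp_inj)
    have "triangulation Q"
    proof (rule triangulationI)
      show "6 * card (verts (skel Q)) = card (arcs (skel Q)) + 12"
        using Q(2) dv(2,3) vP conjunct1[OF five] card_arcs unfolding Qsk(1) Psk(1) by linarith
      fix x assume "x \<in> arcs (skel Q)"
      then have x: "x \<in> arcs (skel P) - {opp d, P.rv (opp d)}" unfolding Qsk .
      then have "x = opp d2 \<or> x \<in> {opp d3, opp d4, opp e} \<or> x \<notin> opp ` out v" using rim by blast
      then have "x = opp d2 \<or> P.fs (P.fs (P.fs x)) = x" using tri_off[of x] x h h4 by auto
      then show "Q.fs (Q.fs (Q.fs x)) = x" by (rule triQ[OF x])
    qed (rule Q)
    moreover have "merge_digon\<^sup>*\<^sup>* P Q" using mP by auto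
    moreover have "card (verts (skel Q)) + 2 = card V" using vP dv(3) by (simp add: Qsk)
    ultimately show ?thesis using contr by blast
  qed
qed

lemma contracts_smaller:
  assumes V: "4 \<le> card V"
  shows "\<exists>N. contracts M N \<and> triangulation N \<and> 3 \<le> card (verts (skel N)) \<and> card (verts (skel N)) < card V"
proof -
  obtain v where v: "v \<in> V" "card (out v) < 6" and inj: "inj_on dst (out v)"
    using exists_small_simple_vertex V by fastforce
  have ne: "out v \<noteq> {}" using out_nonempty[OF v(1)] V by simp
  then obtain d where d: "d \<in> out v" by blast
  have cyc: "cyclic_on rt (out v)" by (rule rot_cyclic[OF v(1) ne])
  define n where "n = card (out v)"
  note per = cyclic_on_funpow_card[OF cyc d, folded n_def]
  have *: "{..<n} = set [0..<n]" by auto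
  have list: "out v = set (map (\<lambda>k. (rt ^^ k) d) [0..<n])" "distinct (map (\<lambda>k. (rt ^^ k) d) [0..<n])"
    using per(2,3) unfolding * by (auto simp: distinct_map)
  \<comment> \<open>Distinct neighbours give at least n + 1 vertices. So for n = 4 or 5, where two
    vertices are lost, at least 3 remain.\<close>
  have "dst ` out v \<subseteq> V - {v}" using no_loops by auto
  then have "n \<le> card (V - {v})" unfolding n_def card_image[OF inj, symmetric] by (intro card_mono) auto
  then have nV: "n + 1 \<le> card V" using v(1) card_Suc_Diff1[of V v] by simp
  have V3: "3 \<le> card V" using V by simp
  have "2 \<le> n" "n < 6" using two_le_card_out[OF v(1) ne] v(2) by (simp_all add: n_def)
  then consider "n = 2" | "n = 3" | "n = 4" | "n = 5" by linarith
  then show ?thesis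
  proof cases
    case 1
    have out2: "out v = {d, rt d}" "d \<noteq> rt d" "rt (rt d) = d"
      using list per(1) unfolding 1 by (simp_all add: upt_rec eval_nat_numeral)
    then obtain N where "contracts M N" "triangulation N" "card (verts (skel N)) + 1 = card V"
      using contract_wheel_2[OF V v(1) out2 inj] by blast
    then show ?thesis using V by (intro exI[of _ N]) simp
  next
    case 2
    have out3: "out v = {d, rt d, rt (rt d)}" "rt (rt (rt d)) = d"
      using list per(1) unfolding 2 by (simp_all add: upt_rec eval_nat_numeral)
    have c3: "card (out v) = 3" using 2 n_def by simp
    obtain N where "contracts M N" "triangulation N" "card (verts (skel N)) + 1 = card V"
      using contract_wheel_3[OF v(1) out3(1) c3 out3(2) inj] by blast
    then show ?thesis using V by (intro exI[of _ N]) simp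
  next
    case 3
    have out4: "out v = {d, rt d, rt (rt d), rt (rt (rt d))}"
      "distinct [d, rt d, rt (rt d), rt (rt (rt d))]" "rt (rt (rt (rt d))) = d"
      using list per(1) unfolding 3 by (simp_all add: upt_rec eval_nat_numeral)
    \<comment> \<open>Starting at \<open>rt d\<close> instead of \<open>d\<close> turns the second
      pair into the first.\<close>
    obtain x where x: "x = d \<or> x = rt d" "\<not> adjacent M (dst x) (dst (rt (rt x)))"
      using alternate_neighbors_not_adjacent[OF V3 _ _ out4(2)] d inj by auto
    have "\<exists>N. contracts M N \<and> triangulation N \<and> card (verts (skel N)) + 2 = card V"
    proof (rule contract_wheel_4_5[OF v(1) _ inj _ _ _ _ x(2)])
      show "x \<in> out v" "rt (rt (rt x)) \<in> out v" using x(1) out4 by auto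
      show "distinct [x, rt x, rt (rt x), rt (rt (rt x))]" "rt (rt (rt (rt x))) = x"
        using x(1) out4(2,3) by auto
      show "card (out v) = 4 \<and> rt (rt (rt x)) = rt (rt (rt x)) \<and>
          out v = {x, rt x, rt (rt x), rt (rt (rt x))} \<or>
        card (out v) = 5 \<and> rt (rt (rt x)) = rt (rt (rt (rt x))) \<and>
          out v = {x, rt x, rt (rt x), rt (rt (rt x)), rt (rt (rt x))}"
        using x(1) out4 3 n_def by auto
    qed
    then obtain N where "contracts M N" "triangulation N" "card (verts (skel N)) + 2 = card V" by blast
    then show ?thesis using nV 3 by (intro exI[of _ N]) simp
  next
    case 4
    have out5: "out v = {d, rt d, rt (rt d), rt (rt (rt d)), rt (rt (rt (rt d)))}"
      "distinct [d, rt d, rt (rt d), rt (rt (rt d)), rt (rt (rt (rt d)))]"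
      "rt (rt (rt (rt (rt d)))) = d"
      using list per(1) unfolding 4 by (simp_all add: upt_rec eval_nat_numeral)
    \<comment> \<open>Four of the five spokes already yield a nonadjacent pair.\<close>
    then have "distinct [d, rt d, rt (rt d), rt (rt (rt d))]" by simp
    then obtain x where x: "x = d \<or> x = rt d" "\<not> adjacent M (dst x) (dst (rt (rt x)))"
      using alternate_neighbors_not_adjacent[OF V3] d inj by auto
    have "\<exists>N. contracts M N \<and> triangulation N \<and> card (verts (skel N)) + 2 = card V"
    proof (rule contract_wheel_4_5[OF v(1) _ inj _ _ _ _ x(2)])
      show "x \<in> out v" "rt (rt (rt (rt x))) \<in> out v" using x(1) out5 by auto
      show "distinct [x, rt x, rt (rt x), rt (rt (rt (rt x)))]" "rt (rt (rt (rt (rt x)))) = x"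
        using x(1) out5(2,3) by auto
      show "card (out v) = 4 \<and> rt (rt (rt (rt x))) = rt (rt (rt x)) \<and>
          out v = {x, rt x, rt (rt x), rt (rt (rt (rt x)))} \<or>
        card (out v) = 5 \<and> rt (rt (rt (rt x))) = rt (rt (rt (rt x))) \<and>
          out v = {x, rt x, rt (rt x), rt (rt (rt x)), rt (rt (rt (rt x)))}"
        using x(1) out5 4 n_def by auto
    qed
    then obtain N where "contracts M N" "triangulation N" "card (verts (skel N)) + 2 = card V" by blast
    then show ?thesis using nV 4 by (intro exI[of _ N]) simp
  qed
qed

end

text \<open>Strong induction, since a contraction may lose one or two vertices.\<close>

lemma triangulation_contracts_to_K3:
  assumes "triangulation M" "3 \<le> card (verts (skel M))"
  shows "\<exists>N. contracts\<^sup>*\<^sup>* M N \<and> K\<^bsub>3\<^esub> (skel N)"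
  using assms
proof (induction "card (verts (skel M))" arbitrary: M rule: less_induct)
  case less
  interpret triangulation M by (rule less.prems)
  show ?case
  proof (cases "card V = 3")
    case True
    then show ?thesis using complete_digraph_3 by blast
  next
    case False
    then obtain N where N: "contracts M N" "triangulation N" "3 \<le> card (verts (skel N))"
        "card (verts (skel N)) < card V"
      using contracts_smaller less.prems by fastforce
    then show ?thesis using less.hyps[OF N(4,2,3)] by (meson converse_rtranclp_into_rtranclp)
  qed
qed

theorem theorem4p4:
  fixes M :: "('v, 'e) comb_map" and n :: nat
  assumes "maximal_planar M"
    and "card (verts (skel M)) = n" and "n \<ge> 3"
  shows "\<exists>N. contracts\<^sup>*\<^sup>* M N \<and> K\<^bsub>3\<^esub> (skel N)"
  using triangulation_contracts_to_K3[OF maximal_planar_imp_triangulation] assms by blast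

end
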